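(* For the Euler equations of gas dynamics, the simple and shock wavespeeds in Eulerian and Lagrangian frames are related by $$\lambda_i^E(w)=u+v\,\lambda_i^L(w),\qquad \sigma_i^E(w)=\bar u+\bar v\,\sigma_i^L(w),$$ respectively, for each family $i\in\{-,0,+\}$, where $\bar u,\bar v$ are the averages of the left and right values across the jump, while the states $w$ across the waves are identical in the two frames (the same pairs of states are connected by simple waves, shocks and contacts), and the waves in the two frames are consistently related by the maps $y=\int^x v(\tilde x,t)\,d\tilde x$ and $x=\int^y\rho(\tilde y,t)\,d\tilde y$ between material coordinate $x$ and spatial coordinate $y$.
   Context: State $w=(p,u,s)$: pressure, velocity, specific entropy. The equation of state is the specific enthalpy $h=h(p,s)$ with $dh=v\,dp+\theta\,ds$; $v=\partial h/\partial p>0$ is the specific volume, $\rho=1/v$ density, $\theta=\partial h/\partial s>0$ temperature, $e=h-pv$ internal energy, and $-\partial v/\partial p>0$, so both systems below are strictly hyperbolic. Lagrangian (material) system: $(-v)_t+u_x=0$, $u_t+p_x=0$, $(\frac12u^2+e)_t+(up)_x=0$. Eulerian (spatial) system: $\rho_t+(\rho u)_y=0$, $(\rho u)_t+(\rho u^2+p)_y=0$, $(\frac12\rho u^2+\rho e)_t+(\frac12\rho u^3+\rho u e+up)_y=0$. Each has the form $q(w)_t+f(w)_z=0$ with $z=x$ (Lagrangian, superscript $L$) or $z=y$ (Eulerian, superscript $E$). $\lambda_i$ denotes the generalized eigenvalues of $Df\,r=\lambda\,Dq\,r$, indexed in increasing order by $-,0,+$; simple wave curves are integral curves of the eigenvectors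 $r_i$. $\sigma_i$ is the speed of an $i$-shock or contact between two states, given by the jump condition $[f]=\sigma[q]$, with $[\cdot]$ = right minus left value. *)

theory Defs
  imports "HOL-Analysis.Analysis"
begin

text \<open>
  A state is a triple \<open>w = (p, u, s)\<close> of pressure, velocity and specific entropy; the equation
  of state is given by the specific enthalpy \<open>h p s\<close>. The thermodynamic functions are obtained
  from \<open>dh = v dp + \<theta> ds\<close>.
\<close>

type_synonym state = "real \<times> real \<times> real"
type_synonym enthalpy = "real \<Rightarrow> real \<Rightarrow> real"

definition spec_volume :: "enthalpy \<Rightarrow> real \<Rightarrow> real \<Rightarrow> real" where
  "spec_volume h p s = deriv (\<lambda>\<pi>. h \<pi> s) p"

definition temperature :: "enthalpy \<Rightarrow> real \<Rightarrow> real \<Rightarrow> real" where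
  "temperature h p s = deriv (\<lambda>\<eta>. h p \<eta>) s"

definition int_energy :: "enthalpy \<Rightarrow> real \<Rightarrow> real \<Rightarrow> real" where
  "int_energy h p s = h p s - p * spec_volume h p s"

definition C1_on :: "('a::real_normed_vector \<Rightarrow> 'b::real_normed_vector) \<Rightarrow> 'a set \<Rightarrow> bool" where
  "C1_on f S \<longleftrightarrow> (\<forall>x\<in>S. f differentiable (at x)) \<and>
     (\<forall>d. continuous_on S (\<lambda>x. frechet_derivative f (at x) d))"

text \<open>
  \<open>D\<close> is the set of thermodynamic states \<open>(p, s)\<close>, for example all \<open>p > 0\<close>. Its isobaric sections
  are intervals, so that at fixed pressure the enthalpy is a strictly increasing function of the
  entropy. The three smoothness clauses say that \<open>h\<close> is of class C2 on \<open>D\<close>.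
\<close>

definition equation_of_state :: "(real \<times> real) set \<Rightarrow> enthalpy \<Rightarrow> bool" where
  "equation_of_state D h \<longleftrightarrow>
     open D \<and> (\<forall>p. is_interval {s. (p, s) \<in> D}) \<and>
     C1_on (\<lambda>(p, s). h p s) D \<and>
     C1_on (\<lambda>(p, s). spec_volume h p s) D \<and>
     C1_on (\<lambda>(p, s). temperature h p s) D \<and>
     (\<forall>(p, s)\<in>D. spec_volume h p s > 0 \<and> temperature h p s > 0 \<and>
        - deriv (\<lambda>\<pi>. spec_volume h \<pi> s) p > 0)"

definition states :: "(real \<times> real) set \<Rightarrow> state set" where
  "states D = {(p, u, s). (p, s) \<in> D}"

definition velocity :: "state \<Rightarrow> real" where
  "velocity = (\<lambda>(p, u, s). u)"

definition state_volume :: "enthalpy \<Rightarrow> state \<Rightarrow> real" where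
  "state_volume h = (\<lambda>(p, u, s). spec_volume h p s)"

definition mass_density :: "enthalpy \<Rightarrow> state \<Rightarrow> real" where
  "mass_density h w = 1 / state_volume h w"

definition average :: "(state \<Rightarrow> real) \<Rightarrow> state \<Rightarrow> state \<Rightarrow> real" where
  "average g wl wr = (g wl + g wr) / 2"

text \<open>A system \<open>(q, f)\<close> stands for the conservation law \<open>q(w)\<^sub>t + f(w)\<^sub>z = 0\<close>.\<close>

type_synonym system = "(state \<Rightarrow> state) \<times> (state \<Rightarrow> state)"

definition lagrangian :: "enthalpy \<Rightarrow> system" where
  "lagrangian h =
    ((\<lambda>(p, u, s). (- spec_volume h p s, u, u\<^sup>2 / 2 + int_energy h p s)),
     (\<lambda>(p, u, s). (u, p, u * p)))"

definition eulerian :: "enthalpy \<Rightarrow> system" where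
  "eulerian h =
    ((\<lambda>(p, u, s). let \<rho> = 1 / spec_volume h p s; e = int_energy h p s in
        (\<rho>, \<rho> * u, \<rho> * u\<^sup>2 / 2 + \<rho> * e)),
     (\<lambda>(p, u, s). let \<rho> = 1 / spec_volume h p s; e = int_energy h p s in
        (\<rho> * u, \<rho> * u\<^sup>2 + p, \<rho> * u ^ 3 / 2 + \<rho> * u * e + u * p)))"

definition gen_eigenpair :: "system \<Rightarrow> state \<Rightarrow> real \<Rightarrow> state \<Rightarrow> bool" where
  "gen_eigenpair S w \<mu> r \<longleftrightarrow>
     r \<noteq> 0 \<and> frechet_derivative (snd S) (at w) r = \<mu> *\<^sub>R frechet_derivative (fst S) (at w) r"

definition gen_spectrum :: "system \<Rightarrow> state \<Rightarrow> real set" where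
  "gen_spectrum S w = {\<mu>. \<exists>r. gen_eigenpair S w \<mu> r}"

definition strictly_hyperbolic_at :: "system \<Rightarrow> state \<Rightarrow> bool" where
  "strictly_hyperbolic_at S w \<longleftrightarrow> card (gen_spectrum S w) = 3"

datatype family = Minus | Zero | Plus

primrec family_index :: "family \<Rightarrow> nat" where
  "family_index Minus = 0"
| "family_index Zero = 1"
| "family_index Plus = 2"

text \<open>Meaningful where the system is strictly hyperbolic.\<close>

definition wavespeed :: "system \<Rightarrow> family \<Rightarrow> state \<Rightarrow> real" where
  "wavespeed S i w = sorted_list_of_set (gen_spectrum S w) ! family_index i"

text \<open>
  Integral curves of the line field spanned by the \<open>i\<close>-th eigenvector; no normalisation of the
  eigenvector, hence of the parameter, is imposed.
\<close>

definition simple_wave_curve ::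
    "system \<Rightarrow> state set \<Rightarrow> family \<Rightarrow> real set \<Rightarrow> (real \<Rightarrow> state) \<Rightarrow> bool" where
  "simple_wave_curve S W i J \<gamma> \<longleftrightarrow>
     open J \<and> is_interval J \<and> \<gamma> C1_differentiable_on J \<and>
     (\<forall>\<tau>\<in>J. \<gamma> \<tau> \<in> W \<and>
        gen_eigenpair S (\<gamma> \<tau>) (wavespeed S i (\<gamma> \<tau>)) (vector_derivative \<gamma> (at \<tau>)))"

definition jump_condition :: "system \<Rightarrow> state \<Rightarrow> state \<Rightarrow> real \<Rightarrow> bool" where
  "jump_condition S wl wr \<sigma> \<longleftrightarrow> snd S wr - snd S wl = \<sigma> *\<^sub>R (fst S wr - fst S wl)"

text \<open>
  A contact moves with the middle characteristic speed of both of its states; shocks of the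
  outer families are slower, respectively faster, than the middle speed on both sides. No
  entropy condition is imposed here.
\<close>

definition shock_or_contact ::
    "system \<Rightarrow> state set \<Rightarrow> family \<Rightarrow> state \<Rightarrow> state \<Rightarrow> real \<Rightarrow> bool" where
  "shock_or_contact S W i wl wr \<sigma> \<longleftrightarrow>
     wl \<in> W \<and> wr \<in> W \<and> wl \<noteq> wr \<and> jump_condition S wl wr \<sigma> \<and>
     (case i of
        Minus \<Rightarrow> \<sigma> < wavespeed S Zero wl \<and> \<sigma> < wavespeed S Zero wr
      | Zero \<Rightarrow> \<sigma> = wavespeed S Zero wl \<and> \<sigma> = wavespeed S Zero wr
      | Plus \<Rightarrow> \<sigma> > wavespeed S Zero wl \<and> \<sigma> > wavespeed S Zero wr)"

text \<open>Shocks that are admissible in the sense of Lax.\<close>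

definition lax_shock ::
    "system \<Rightarrow> state set \<Rightarrow> family \<Rightarrow> state \<Rightarrow> state \<Rightarrow> real \<Rightarrow> bool" where
  "lax_shock S W i wl wr \<sigma> \<longleftrightarrow>
     shock_or_contact S W i wl wr \<sigma> \<and>
     wavespeed S i wr < \<sigma> \<and> \<sigma> < wavespeed S i wl \<and>
     (\<forall>j. family_index j < family_index i \<longrightarrow> wavespeed S j wl < \<sigma>) \<and>
     (\<forall>j. family_index i < family_index j \<longrightarrow> \<sigma> < wavespeed S j wr)"

text \<open>Flows are functions of points \<open>(z, t)\<close>, with \<open>z\<close> the material or spatial coordinate.\<close>

definition classical_solution ::
    "system \<Rightarrow> state set \<Rightarrow> (real \<times> real) set \<Rightarrow> (real \<times> real \<Rightarrow> state) \<Rightarrow> bool" where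
  "classical_solution S W U w \<longleftrightarrow>
     w ` U \<subseteq> W \<and> C1_on w U \<and>
     (\<forall>(z, t)\<in>U. \<exists>a b.
        ((\<lambda>\<tau>. fst S (w (z, \<tau>))) has_vector_derivative a) (at t) \<and>
        ((\<lambda>\<zeta>. snd S (w (\<zeta>, t))) has_vector_derivative b) (at z) \<and>
        a + b = 0)"

text \<open>A simple wave is a smooth flow all of whose states lie on one simple wave curve.\<close>

definition simple_wave ::
    "system \<Rightarrow> state set \<Rightarrow> family \<Rightarrow> real set \<Rightarrow> (real \<Rightarrow> state) \<Rightarrow>
     (real \<times> real) set \<Rightarrow> (real \<times> real \<Rightarrow> state) \<Rightarrow> bool" where
  "simple_wave S W i J \<gamma> U w \<longleftrightarrow>
     simple_wave_curve S W i J \<gamma> \<and> classical_solution S W U w \<and>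
     (\<exists>\<phi>. C1_on \<phi> U \<and> (\<forall>P\<in>U. \<phi> P \<in> J \<and> w P = \<gamma> (\<phi> P)))"

text \<open>A single shock or contact separating two constant states.\<close>

definition jump_wave ::
    "system \<Rightarrow> state set \<Rightarrow> family \<Rightarrow> state \<Rightarrow> state \<Rightarrow> real \<Rightarrow>
     (real \<times> real) set \<Rightarrow> (real \<times> real \<Rightarrow> state) \<Rightarrow> bool" where
  "jump_wave S W i wl wr \<sigma> U w \<longleftrightarrow>
     shock_or_contact S W i wl wr \<sigma> \<and>
     (\<exists>z0. \<forall>(z, t)\<in>U. w (z, t) = (if z < z0 + \<sigma> * t then wl else wr))"

text \<open>
  At time \<open>t\<close> the flow \<open>w\<close>, not necessarily piecewise constant, has a shock or contact on the
  (possibly curved) path \<open>Z\<close>, with the one-sided limits \<open>wl\<close> and \<open>wr\<close>.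
\<close>

definition front_at ::
    "system \<Rightarrow> state set \<Rightarrow> family \<Rightarrow> state \<Rightarrow> state \<Rightarrow> real \<Rightarrow>
     (real \<times> real \<Rightarrow> state) \<Rightarrow> (real \<Rightarrow> real) \<Rightarrow> real \<Rightarrow> bool" where
  "front_at S W i wl wr \<sigma> w Z t \<longleftrightarrow>
     shock_or_contact S W i wl wr \<sigma> \<and>
     (Z has_real_derivative \<sigma>) (at t) \<and>
     (w \<longlongrightarrow> wl) (at (Z t, t) within {(z, \<tau>). z < Z \<tau>}) \<and>
     (w \<longlongrightarrow> wr) (at (Z t, t) within {(z, \<tau>). z > Z \<tau>})"

text \<open>
  \<open>g\<close> is the indefinite integral of \<open>a dz + b dt\<close> on \<open>U\<close>, in integrated form so that it makes
  sense across discontinuities.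
\<close>

definition integral_of_form ::
    "(real \<times> real) set \<Rightarrow> (real \<times> real \<Rightarrow> real) \<Rightarrow> (real \<times> real \<Rightarrow> real) \<Rightarrow>
     (real \<times> real \<Rightarrow> real) \<Rightarrow> bool" where
  "integral_of_form U a b g \<longleftrightarrow>
     (\<forall>z1 z2 t. z1 \<le> z2 \<and> {z1..z2} \<times> {t} \<subseteq> U \<longrightarrow>
        ((\<lambda>\<zeta>. a (\<zeta>, t)) has_integral (g (z2, t) - g (z1, t))) {z1..z2}) \<and>
     (\<forall>z t1 t2. t1 \<le> t2 \<and> {z} \<times> {t1..t2} \<subseteq> U \<longrightarrow>
        ((\<lambda>\<tau>. b (z, \<tau>)) has_integral (g (z, t2) - g (z, t1))) {t1..t2})"

text \<open>
  A flow \<open>wL\<close> in the material coordinate and a flow \<open>wE\<close> in the spatial coordinate correspond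
  via the mutually inverse maps \<open>y = \<integral> v dx\<close> and \<open>x = \<integral> \<rho> dy\<close> at each time. The indefinite
  integrals in space leave a function of time undetermined; it is fixed, up to a constant, by
  the meaning of the material coordinate: particles, which have constant \<open>x\<close>, move with velocity
  \<open>u\<close>, that is \<open>dy = v dx + u dt\<close> and \<open>dx = \<rho> dy - \<rho> u dt\<close>.
\<close>

definition frames_related ::
    "enthalpy \<Rightarrow> state set \<Rightarrow>
     (real \<times> real) set \<Rightarrow> (real \<times> real \<Rightarrow> state) \<Rightarrow> (real \<times> real \<Rightarrow> real) \<Rightarrow>
     (real \<times> real) set \<Rightarrow> (real \<times> real \<Rightarrow> state) \<Rightarrow> (real \<times> real \<Rightarrow> real) \<Rightarrow> bool" where
  "frames_related h W UL wL y UE wE x \<longleftrightarrow>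
     open UL \<and> connected UL \<and> wL ` UL \<subseteq> W \<and>
     open UE \<and> connected UE \<and> wE ` UE \<subseteq> W \<and>
     (\<forall>(\<xi>, t)\<in>UL. (y (\<xi>, t), t) \<in> UE \<and> x (y (\<xi>, t), t) = \<xi> \<and> wE (y (\<xi>, t), t) = wL (\<xi>, t)) \<and>
     (\<forall>(\<eta>, t)\<in>UE. (x (\<eta>, t), t) \<in> UL \<and> y (x (\<eta>, t), t) = \<eta>) \<and>
     integral_of_form UL (\<lambda>P. state_volume h (wL P)) (\<lambda>P. velocity (wL P)) y \<and>
     integral_of_form UE (\<lambda>P. mass_density h (wE P)) (\<lambda>P. - mass_density h (wE P) * velocity (wE P)) x"

definition open_rectangle :: "(real \<times> real) set \<Rightarrow> bool" where
  "open_rectangle U \<longleftrightarrow> (\<exists>I T. open I \<and> is_interval I \<and> open T \<and> is_interval T \<and> U = I \<times> T)"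

end

theory Submission
  imports Defs
begin

text \<open>
  All parts of the theorem come from one fact: the Lagrangian and the Eulerian system describe the
  same flow in coordinates that are linked by \<open>dy = v dx + u dt\<close>.

  At a point, this change of coordinate replaces \<open>w\<^sub>t, w\<^sub>x\<close> by \<open>w\<^sub>t - (u / v) w\<^sub>x, w\<^sub>x / v\<close>, and
  \<open>balance_iff\<close> shows that the three linearised balance laws of one system are combinations of those
  of the other. Inserting a plane wave \<open>w\<^sub>t = - \<lambda> w\<^sub>x\<close> identifies the eigenvectors and maps \<open>\<lambda>\<close> to
  \<open>u + v \<lambda>\<close>; as \<open>v > 0\<close> this map keeps the order of the eigenvalues, hence the families
  (\<open>gen_eigenpair_iff\<close>, \<open>wavespeeds\<close>). Inserting an actual flow identifies the classical solutions.

  Across a jump the same combination of the balance laws works with finite differences. A jump of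
  Lagrangian speed \<open>\<sigma>\<close> has the Eulerian speed \<open>u + v \<sigma>\<close>, computed from the state on either side; the mass
  balance \<open>[u] = - \<sigma> [v]\<close> is the equality of the two values, and their mean is the formula with averages
  (\<open>jump_condition_iff\<close>). The speed is determined by the two states because not all conserved
  quantities can be continuous: the enthalpy would be, too, and it determines the entropy at given
  pressure (\<open>lagrangian_speed_unique\<close>).

  The correspondence of flows is symmetric: \<open>dx = (1 / v) dy - (u / v) dt\<close> has the same shape as
  \<open>dy = v dx + u dt\<close>. The locale \<open>frame_change\<close> therefore treats a general form \<open>A dz + B dt\<close>, with \<open>A\<close>
  and \<open>B\<close> functions of the state and \<open>A > 0\<close>, and every result about it is used once in each direction.
  For a smooth flow the change of coordinate is a diffeomorphism. For a straight
  front between constant states it is an explicit piecewise linear map, up to a constant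
  (\<open>kinked_map\<close>, \<open>integral_of_form_unique\<close>). At a general front only the one-sided limits of the flow are
  known, and the image of the front is found by estimating integrals along paths that avoid it
  (\<open>front_velocity\<close>, \<open>front_preimage\<close>). Conversely, a smooth flow on a rectangle has a corresponding flow in
  the other frame because the form is closed, and this closedness is the mass balance
  (\<open>classical_frame_change\<close>).
\<close>
section \<open>Continuously differentiable maps\<close>

lemma C1_onI:
  assumes "\<And>x. x \<in> S \<Longrightarrow> (f has_derivative F x) (at x)"
    and "\<And>d. continuous_on S (\<lambda>x. F x d)"
  shows "C1_on f S"
proof -
  have "frechet_derivative f (at x) = F x" if "x \<in> S" for x
    using assms(1)[OF that] frechet_derivative_at by metis
  then have "continuous_on S (\<lambda>x. frechet_derivative f (at x) d)" for d
    using assms(2)[of d] by (simp cong: continuous_on_cong)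
  then show ?thesis
    using assms(1) unfolding C1_on_def differentiable_def by blast
qed

lemma C1_on_has_derivative:
  assumes "C1_on f S" "x \<in> S"
  shows "(f has_derivative frechet_derivative f (at x)) (at x)"
  using assms by (simp add: C1_on_def frechet_derivative_works)

lemma C1_on_continuous_on:
  assumes "C1_on f S"
  shows "continuous_on S f"
  using C1_on_has_derivative[OF assms] has_derivative_continuous
  by (blast intro: continuous_at_imp_continuous_on)

text \<open>
  Only single directional derivatives are known to be continuous, while the direction in which \<open>f\<close> is
  differentiated varies with the point. As the middle space is finite-dimensional, this direction can
  be expanded in a basis.
\<close>

lemma C1_on_compose:
  fixes g :: "'a::real_normed_vector \<Rightarrow> 'b::euclidean_space"
  assumes f: "C1_on f T" and g: "C1_on g S" and sub: "\<And>x. x \<in> S \<Longrightarrow> g x \<in> T"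
  shows "C1_on (\<lambda>x. f (g x)) S"
proof (rule C1_onI)
  define F where "F = (\<lambda>x. frechet_derivative f (at x))"
  define G where "G = (\<lambda>x. frechet_derivative g (at x))"
  show "((\<lambda>x. f (g x)) has_derivative (\<lambda>d. F (g x) (G x d))) (at x)" if "x \<in> S" for x
    unfolding F_def G_def
    using has_derivative_compose[OF C1_on_has_derivative[OF g that] C1_on_has_derivative[OF f sub[OF that]]] .
  have expand: "(\<Sum>b\<in>Basis. (G x d \<bullet> b) *\<^sub>R F (g x) b) = F (g x) (G x d)" if "x \<in> S" for x d
  proof -
    interpret bounded_linear "F (g x)"
      unfolding F_def using C1_on_has_derivative[OF f sub[OF that]] has_derivative_bounded_linear by blast
    show ?thesis
      by (subst (2) euclidean_representation[of "G x d", symmetric]) (simp add: sum scaleR)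
  qed
  have "continuous_on S (\<lambda>x. F (g x) b)" for b
    using f sub C1_on_continuous_on[OF g] unfolding F_def C1_on_def
    by (intro continuous_on_compose2[of T "\<lambda>y. frechet_derivative f (at y) b" S g]) auto
  moreover have "continuous_on S (\<lambda>x. G x d)" for d
    using g unfolding G_def C1_on_def by blast
  ultimately have "continuous_on S (\<lambda>x. \<Sum>b\<in>Basis. (G x d \<bullet> b) *\<^sub>R F (g x) b)" for d
    by (intro continuous_intros) auto
  then show "continuous_on S (\<lambda>x. F (g x) (G x d))" for d
    using expand by (simp cong: continuous_on_cong)
qed

lemma C1_on_cong:
  assumes "open S" "C1_on f S" "\<And>x. x \<in> S \<Longrightarrow> f x = g x"
  shows "C1_on g S"
proof (rule C1_onI)
  show "(g has_derivative frechet_derivative f (at x)) (at x)" if "x \<in> S" for x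
    using has_derivative_transform_within_open[OF C1_on_has_derivative[OF assms(2) that] assms(1) that assms(3)] .
  show "continuous_on S (\<lambda>x. frechet_derivative f (at x) d)" for d
    using assms(2) by (simp add: C1_on_def)
qed

section \<open>Indefinite integrals of one-forms\<close>

lemma eventually_nhds_box:
  fixes z t :: real
  shows "eventually P (nhds (z, t)) \<longleftrightarrow>
    (\<exists>\<delta>>0. \<forall>\<zeta> \<tau>. \<bar>\<zeta> - z\<bar> < \<delta> \<longrightarrow> \<bar>\<tau> - t\<bar> < \<delta> \<longrightarrow> P (\<zeta>, \<tau>))" (is "?L \<longleftrightarrow> ?R")
proof
  assume ?L
  then obtain e where e: "e > 0" "\<And>Q. dist Q (z, t) < e \<Longrightarrow> P Q"
    unfolding eventually_nhds_metric by blast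
  have "P (\<zeta>, \<tau>)" if "\<bar>\<zeta> - z\<bar> < e / 2" "\<bar>\<tau> - t\<bar> < e / 2" for \<zeta> \<tau>
  proof (rule e(2))
    have "dist (\<zeta>, \<tau>) (z, t) \<le> \<bar>\<zeta> - z\<bar> + \<bar>\<tau> - t\<bar>"
      using sqrt_sum_squares_le_sum_abs[of "\<zeta> - z" "\<tau> - t"] by (simp add: dist_Pair_Pair dist_real_def)
    then show "dist (\<zeta>, \<tau>) (z, t) < e" using that by simp
  qed
  then show ?R using \<open>e > 0\<close> by (intro exI[of _ "e / 2"]) auto
next
  assume ?R
  then obtain \<delta> where d: "\<delta> > 0" "\<And>\<zeta> \<tau>. \<bar>\<zeta> - z\<bar> < \<delta> \<Longrightarrow> \<bar>\<tau> - t\<bar> < \<delta> \<Longrightarrow> P (\<zeta>, \<tau>)" by blast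
  have "P Q" if "dist Q (z, t) < \<delta>" for Q
  proof -
    have "dist (fst Q) z < \<delta>" "dist (snd Q) t < \<delta>"
      using that dist_fst_le[of Q "(z, t)"] dist_snd_le[of Q "(z, t)"] by auto
    then show ?thesis using d(2)[of "fst Q" "snd Q"] by (simp add: dist_real_def)
  qed
  then show ?L unfolding eventually_nhds_metric using d(1) by blast
qed

lemma open_contains_box:
  fixes z t :: real
  assumes "open U" "(z, t) \<in> U"
  obtains \<delta> where "\<delta> > 0" "\<And>\<zeta> \<tau>. \<bar>\<zeta> - z\<bar> < \<delta> \<Longrightarrow> \<bar>\<tau> - t\<bar> < \<delta> \<Longrightarrow> (\<zeta>, \<tau>) \<in> U"
  using eventually_nhds_in_open[OF assms] unfolding eventually_nhds_box by blast

lemma closed_segment_abs_bound: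
  fixes a b x z :: real
  assumes "x \<in> closed_segment a b" "\<bar>a - z\<bar> \<le> r" "\<bar>b - z\<bar> \<le> r"
  shows "\<bar>x - z\<bar> \<le> r"
  using assms by (auto simp: closed_segment_eq_real_ivl split: if_splits)

lemma has_integral_near_constant:
  fixes F :: "real \<Rightarrow> real"
  assumes "(F has_integral I) {a..b}" "a \<le> b" "finite N" "0 \<le> e"
    and "\<And>x. x \<in> {a..b} - N \<Longrightarrow> \<bar>F x - c\<bar> \<le> e"
  shows "\<bar>I - c * (b - a)\<bar> \<le> e * (b - a)"
proof -
  have "((\<lambda>x. F x - c) has_integral (I - c * (b - a))) (cbox a b)"
    using has_integral_diff[OF assms(1) has_integral_const_real[of c a b]] assms(2)
    by (simp add: mult.commute)
  from has_integral_bound_spike_finite[OF assms(4,3) this] assms(2,5)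
  show ?thesis by simp
qed

text \<open>
  Along a segment on which the coefficient stays close to a constant the indefinite integral is
  close to linear. Finitely many points may be exempt: this is what makes the estimates usable at a
  front, where nothing is known about the flow on the front itself.
\<close>

lemma integral_of_form_horizontal:
  assumes "integral_of_form U a b g" "closed_segment z1 z2 \<times> {t} \<subseteq> U" "finite N" "0 \<le> e"
    and "\<And>\<zeta>. \<zeta> \<in> closed_segment z1 z2 \<Longrightarrow> \<zeta> \<notin> N \<Longrightarrow> \<bar>a (\<zeta>, t) - c\<bar> \<le> e"
  shows "\<bar>g (z2, t) - g (z1, t) - c * (z2 - z1)\<bar> \<le> e * \<bar>z2 - z1\<bar>"
proof (cases "z1 \<le> z2")
  case True
  with has_integral_near_constant[of "\<lambda>\<zeta>. a (\<zeta>, t)" "g (z2, t) - g (z1, t)" z1 z2 N e c] assms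
  show ?thesis by (auto simp: integral_of_form_def closed_segment_eq_real_ivl)
next
  case False
  with has_integral_near_constant[of "\<lambda>\<zeta>. a (\<zeta>, t)" "g (z1, t) - g (z2, t)" z2 z1 N e c] assms
  have "\<bar>g (z1, t) - g (z2, t) - c * (z1 - z2)\<bar> \<le> e * (z1 - z2)"
    by (auto simp: integral_of_form_def closed_segment_eq_real_ivl)
  moreover have "g (z1, t) - g (z2, t) - c * (z1 - z2) = - (g (z2, t) - g (z1, t) - c * (z2 - z1))"
    by (simp add: algebra_simps)
  ultimately show ?thesis using False by (simp add: abs_minus_commute)
qed

lemma integral_of_form_vertical:
  assumes "integral_of_form U a b g" "{z} \<times> closed_segment t1 t2 \<subseteq> U" "finite N" "0 \<le> e"
    and "\<And>\<tau>. \<tau> \<in> closed_segment t1 t2 \<Longrightarrow> \<tau> \<notin> N \<Longrightarrow> \<bar>b (z, \<tau>) - c\<bar> \<le> e"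
  shows "\<bar>g (z, t2) - g (z, t1) - c * (t2 - t1)\<bar> \<le> e * \<bar>t2 - t1\<bar>"
proof (cases "t1 \<le> t2")
  case True
  with has_integral_near_constant[of "\<lambda>\<tau>. b (z, \<tau>)" "g (z, t2) - g (z, t1)" t1 t2 N e c] assms
  show ?thesis by (auto simp: integral_of_form_def closed_segment_eq_real_ivl)
next
  case False
  with has_integral_near_constant[of "\<lambda>\<tau>. b (z, \<tau>)" "g (z, t1) - g (z, t2)" t2 t1 N e c] assms
  have "\<bar>g (z, t1) - g (z, t2) - c * (t1 - t2)\<bar> \<le> e * (t1 - t2)"
    by (auto simp: integral_of_form_def closed_segment_eq_real_ivl)
  moreover have "g (z, t1) - g (z, t2) - c * (t1 - t2) = - (g (z, t2) - g (z, t1) - c * (t2 - t1))"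
    by (simp add: algebra_simps)
  ultimately show ?thesis using False by (simp add: abs_minus_commute)
qed

lemma integral_of_form_continuous_on_horizontal:
  assumes "integral_of_form U a b g" "{z1..z2} \<times> {t} \<subseteq> U"
  shows "continuous_on {z1..z2} (\<lambda>\<zeta>. g (\<zeta>, t))"
proof (cases "z1 \<le> z2")
  case True
  have I: "((\<lambda>\<zeta>. a (\<zeta>, t)) has_integral (g (\<zeta>, t) - g (z1, t))) {z1..\<zeta>}" if "\<zeta> \<in> {z1..z2}" for \<zeta>
  proof -
    have "{z1..\<zeta>} \<times> {t} \<subseteq> U" using that assms(2) by auto
    then show ?thesis using assms(1) that unfolding integral_of_form_def by auto
  qed
  then have "(\<lambda>\<zeta>. a (\<zeta>, t)) integrable_on {z1..z2}" using True by (meson atLeastAtMost_iff has_integral_integrable order_refl)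
  from continuous_on_add[OF indefinite_integral_continuous_1[OF this] continuous_on_const[of _ "g (z1, t)"]]
  show ?thesis by (rule continuous_on_eq) (use I[THEN integral_unique] in auto)
qed auto

text \<open>
  The increment is computed along a horizontal and then a vertical segment; both coefficients are
  almost constant near the point.
\<close>

lemma integral_of_form_has_derivative:
  assumes form: "integral_of_form U a b g" and "open U" "(z, t) \<in> U"
    and a: "continuous_on U a" and b: "continuous_on U b"
  shows "(g has_derivative (\<lambda>d. a (z, t) * fst d + b (z, t) * snd d)) (at (z, t))"
  unfolding has_derivative_at_alt
proof (intro conjI allI impI)
  show "bounded_linear (\<lambda>d. a (z, t) * fst d + b (z, t) * snd d)"
    by (intro bounded_linear_add bounded_linear_const_mult bounded_linear_fst bounded_linear_snd)
  fix e :: real assume "e > 0"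
  define e' where "e' = e / 2"
  have "e' > 0" using \<open>e > 0\<close> by (simp add: e'_def)
  have "eventually (\<lambda>P. P \<in> U) (nhds (z, t))"
    using \<open>open U\<close> \<open>(z, t) \<in> U\<close> by (rule eventually_nhds_in_open)
  moreover have "eventually (\<lambda>P. dist (a P) (a (z, t)) < e') (nhds (z, t))"
      "eventually (\<lambda>P. dist (b P) (b (z, t)) < e') (nhds (z, t))"
    using a b \<open>open U\<close> \<open>(z, t) \<in> U\<close> \<open>e' > 0\<close>
    by (auto simp: continuous_on_eq_continuous_at continuous_at_eps_delta eventually_nhds_metric)
  ultimately have "eventually (\<lambda>P. P \<in> U \<and> \<bar>a P - a (z, t)\<bar> \<le> e' \<and> \<bar>b P - b (z, t)\<bar> \<le> e') (nhds (z, t))"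
    by eventually_elim (auto simp: dist_real_def)
  then obtain \<delta> where "\<delta> > 0" and d: "\<And>\<zeta> \<tau>. \<bar>\<zeta> - z\<bar> < \<delta> \<Longrightarrow> \<bar>\<tau> - t\<bar> < \<delta> \<Longrightarrow>
      (\<zeta>, \<tau>) \<in> U \<and> \<bar>a (\<zeta>, \<tau>) - a (z, t)\<bar> \<le> e' \<and> \<bar>b (\<zeta>, \<tau>) - b (z, t)\<bar> \<le> e'"
    unfolding eventually_nhds_box by blast
  have "\<bar>g (\<zeta>, \<tau>) - g (z, t) - (a (z, t) * (\<zeta> - z) + b (z, t) * (\<tau> - t))\<bar> \<le> e * norm ((\<zeta>, \<tau>) - (z, t))"
    if "norm ((\<zeta>, \<tau>) - (z, t)) < \<delta>" for \<zeta> \<tau>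
  proof -
    have n: "\<bar>\<zeta> - z\<bar> \<le> norm ((\<zeta>, \<tau>) - (z, t))" "\<bar>\<tau> - t\<bar> \<le> norm ((\<zeta>, \<tau>) - (z, t))"
      using norm_fst_le[of "\<zeta> - z" "\<tau> - t"] norm_snd_le[of "\<tau> - t" "\<zeta> - z"] by auto
    then have lt: "\<bar>\<zeta> - z\<bar> < \<delta>" "\<bar>\<tau> - t\<bar> < \<delta>" using that by auto
    have s1: "\<bar>x - z\<bar> < \<delta>" if "x \<in> closed_segment z \<zeta>" for x
      using closed_segment_abs_bound[OF that, of z "\<bar>\<zeta> - z\<bar>"] lt by auto
    have s2: "\<bar>x - t\<bar> < \<delta>" if "x \<in> closed_segment t \<tau>" for x
      using closed_segment_abs_bound[OF that, of t "\<bar>\<tau> - t\<bar>"] lt by auto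
    have "\<bar>g (\<zeta>, t) - g (z, t) - a (z, t) * (\<zeta> - z)\<bar> \<le> e' * \<bar>\<zeta> - z\<bar>"
      using d s1 \<open>\<delta> > 0\<close> \<open>e' > 0\<close> by (intro integral_of_form_horizontal[OF form, where N = "{}"]) auto
    moreover have "\<bar>g (\<zeta>, \<tau>) - g (\<zeta>, t) - b (z, t) * (\<tau> - t)\<bar> \<le> e' * \<bar>\<tau> - t\<bar>"
      using d s2 lt \<open>e' > 0\<close> by (intro integral_of_form_vertical[OF form, where N = "{}"]) auto
    ultimately have "\<bar>g (\<zeta>, \<tau>) - g (z, t) - (a (z, t) * (\<zeta> - z) + b (z, t) * (\<tau> - t))\<bar>
        \<le> e' * \<bar>\<zeta> - z\<bar> + e' * \<bar>\<tau> - t\<bar>" by linarith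
    also have "\<dots> \<le> e' * norm ((\<zeta>, \<tau>) - (z, t)) + e' * norm ((\<zeta>, \<tau>) - (z, t))"
      using n \<open>e' > 0\<close> by (intro add_mono mult_left_mono) auto
    finally show ?thesis by (simp add: e'_def)
  qed
  then have "\<bar>g Q - g (z, t) - (a (z, t) * fst (Q - (z, t)) + b (z, t) * snd (Q - (z, t)))\<bar> \<le> e * norm (Q - (z, t))"
    if "norm (Q - (z, t)) < \<delta>" for Q
    using that by (cases Q) simp
  with \<open>\<delta> > 0\<close> show "\<exists>d>0. \<forall>Q. norm (Q - (z, t)) < d \<longrightarrow>
      norm (g Q - g (z, t) - (a (z, t) * fst (Q - (z, t)) + b (z, t) * snd (Q - (z, t)))) \<le> e * norm (Q - (z, t))"
    unfolding real_norm_def by metis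
qed

lemma has_derivative_integral_of_form:
  assumes "\<And>z t. (z, t) \<in> U \<Longrightarrow> (g has_derivative (\<lambda>d. a (z, t) * fst d + b (z, t) * snd d)) (at (z, t))"
  shows "integral_of_form U a b g"
  unfolding integral_of_form_def
proof (intro conjI allI impI; elim conjE)
  fix z1 z2 t :: real assume "z1 \<le> z2" and sub: "{z1..z2} \<times> {t} \<subseteq> U"
  have "((\<lambda>\<zeta>. g (\<zeta>, t)) has_vector_derivative a (\<zeta>, t)) (at \<zeta> within {z1..z2})" if "\<zeta> \<in> {z1..z2}" for \<zeta>
  proof -
    have line: "((\<lambda>\<zeta>. (\<zeta>, t)) has_derivative (\<lambda>d. (d, 0))) (at \<zeta>)" by (auto intro!: derivative_eq_intros)
    have "(\<zeta>, t) \<in> U" using that sub by auto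
    from has_derivative_compose[OF line assms[OF this]]
    have "((\<lambda>\<zeta>. g (\<zeta>, t)) has_derivative (\<lambda>d. a (\<zeta>, t) * d)) (at \<zeta>)" by simp
    then show ?thesis by (auto simp: has_vector_derivative_def mult.commute intro: has_derivative_at_withinI)
  qed
  with \<open>z1 \<le> z2\<close> show "((\<lambda>\<zeta>. a (\<zeta>, t)) has_integral (g (z2, t) - g (z1, t))) {z1..z2}"
    by (intro fundamental_theorem_of_calculus) auto
next
  fix z t1 t2 :: real assume "t1 \<le> t2" and sub: "{z} \<times> {t1..t2} \<subseteq> U"
  have "((\<lambda>\<tau>. g (z, \<tau>)) has_vector_derivative b (z, \<tau>)) (at \<tau> within {t1..t2})" if "\<tau> \<in> {t1..t2}" for \<tau>
  proof -
    have line: "((\<lambda>\<tau>. (z, \<tau>)) has_derivative (\<lambda>d. (0, d))) (at \<tau>)" by (auto intro!: derivative_eq_intros)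
    have "(z, \<tau>) \<in> U" using that sub by auto
    from has_derivative_compose[OF line assms[OF this]]
    have "((\<lambda>\<tau>. g (z, \<tau>)) has_derivative (\<lambda>d. b (z, \<tau>) * d)) (at \<tau>)" by simp
    then show ?thesis by (auto simp: has_vector_derivative_def mult.commute intro: has_derivative_at_withinI)
  qed
  with \<open>t1 \<le> t2\<close> show "((\<lambda>\<tau>. b (z, \<tau>)) has_integral (g (z, t2) - g (z, t1))) {t1..t2}"
    by (intro fundamental_theorem_of_calculus) auto
qed

text \<open>
  Any two integrals have the same increments on axis-parallel segments, so their difference is
  constant on small boxes.
\<close>

lemma integral_of_form_unique:
  assumes "open U" "connected U" and g1: "integral_of_form U a b g1" and g2: "integral_of_form U a b g2"
  shows "\<exists>c. \<forall>P\<in>U. g1 P = g2 P + c"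
proof -
  define f where "f = (\<lambda>P. g1 P - g2 P)"
  have hor': "f (z1, t) = f (z2, t)" if "z1 \<le> z2" "{z1..z2} \<times> {t} \<subseteq> U" for z1 z2 t
  proof -
    have "((\<lambda>\<zeta>. a (\<zeta>, t)) has_integral (g1 (z2, t) - g1 (z1, t))) {z1..z2}"
      "((\<lambda>\<zeta>. a (\<zeta>, t)) has_integral (g2 (z2, t) - g2 (z1, t))) {z1..z2}"
      using that g1 g2 by (simp_all add: integral_of_form_def)
    from has_integral_unique[OF this] show ?thesis by (simp add: f_def)
  qed
  have ver': "f (z, t1) = f (z, t2)" if "t1 \<le> t2" "{z} \<times> {t1..t2} \<subseteq> U" for z t1 t2
  proof -
    have "((\<lambda>\<tau>. b (z, \<tau>)) has_integral (g1 (z, t2) - g1 (z, t1))) {t1..t2}"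
      "((\<lambda>\<tau>. b (z, \<tau>)) has_integral (g2 (z, t2) - g2 (z, t1))) {t1..t2}"
      using that g1 g2 by (simp_all add: integral_of_form_def)
    from has_integral_unique[OF this] show ?thesis by (simp add: f_def)
  qed
  have hor: "f (z1, t) = f (z2, t)" if "closed_segment z1 z2 \<times> {t} \<subseteq> U" for z1 z2 t
  proof (cases "z1 \<le> z2")
    case True
    with that show ?thesis by (intro hor') (simp_all add: closed_segment_eq_real_ivl)
  next
    case False
    with that have "f (z2, t) = f (z1, t)" by (intro hor') (simp_all add: closed_segment_eq_real_ivl)
    then show ?thesis by simp
  qed
  have ver: "f (z, t1) = f (z, t2)" if "{z} \<times> closed_segment t1 t2 \<subseteq> U" for z t1 t2
  proof (cases "t1 \<le> t2")
    case True
    with that show ?thesis by (intro ver') (simp_all add: closed_segment_eq_real_ivl)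
  next
    case False
    with that have "f (z, t2) = f (z, t1)" by (intro ver') (simp_all add: closed_segment_eq_real_ivl)
    then show ?thesis by simp
  qed
  have loc: "eventually (\<lambda>Q. f (z, t) = f Q) (nhds (z, t))" if "(z, t) \<in> U" for z t
  proof -
    obtain \<delta> where "\<delta> > 0" and d: "\<And>\<zeta> \<tau>. \<bar>\<zeta> - z\<bar> < \<delta> \<Longrightarrow> \<bar>\<tau> - t\<bar> < \<delta> \<Longrightarrow> (\<zeta>, \<tau>) \<in> U"
      using open_contains_box[OF \<open>open U\<close> \<open>(z, t) \<in> U\<close>] by metis
    have "f (z, t) = f (\<zeta>, \<tau>)" if lt: "\<bar>\<zeta> - z\<bar> < \<delta>" "\<bar>\<tau> - t\<bar> < \<delta>" for \<zeta> \<tau>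
    proof -
      have s1: "\<bar>x - z\<bar> < \<delta>" if "x \<in> closed_segment z \<zeta>" for x
        using closed_segment_abs_bound[OF that, of z "\<bar>\<zeta> - z\<bar>"] lt by auto
      have s2: "\<bar>x - t\<bar> < \<delta>" if "x \<in> closed_segment t \<tau>" for x
        using closed_segment_abs_bound[OF that, of t "\<bar>\<tau> - t\<bar>"] lt by auto
      have "f (z, t) = f (\<zeta>, t)" using d s1 \<open>\<delta> > 0\<close> by (intro hor) auto
      also have "\<dots> = f (\<zeta>, \<tau>)" using d s2 lt by (intro ver) auto
      finally show ?thesis .
    qed
    then show ?thesis unfolding eventually_nhds_box using \<open>\<delta> > 0\<close> by blast
  qed
  have "f P = f Q" if "P \<in> U" "Q \<in> U" for P Q
  proof (rule connected_local_const[OF \<open>connected U\<close> that], safe)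
    fix z t assume "(z, t) \<in> U"
    from loc[OF this] show "eventually (\<lambda>Q. f (z, t) = f Q) (at (z, t) within U)"
      by (auto simp: eventually_at_filter elim: eventually_mono)
  qed
  then have "\<exists>c. \<forall>P\<in>U. f P = c" by blast
  then obtain c where "\<forall>P\<in>U. f P = c" by blast
  then show ?thesis by (intro exI[of _ c]) (auto simp: f_def)
qed

lemma integral_of_form_cong:
  assumes "\<And>P. P \<in> U \<Longrightarrow> a P = a' P" "\<And>P. P \<in> U \<Longrightarrow> b P = b' P"
  shows "integral_of_form U a b g \<longleftrightarrow> integral_of_form U a' b' g"
proof -
  have "((\<lambda>\<zeta>. a (\<zeta>, t)) has_integral I) {z1..z2} \<longleftrightarrow> ((\<lambda>\<zeta>. a' (\<zeta>, t)) has_integral I) {z1..z2}"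
    if "{z1..z2} \<times> {t} \<subseteq> U" for z1 z2 t I
    using that by (intro has_integral_cong assms(1)) auto
  moreover have "((\<lambda>\<tau>. b (z, \<tau>)) has_integral I) {t1..t2} \<longleftrightarrow> ((\<lambda>\<tau>. b' (z, \<tau>)) has_integral I) {t1..t2}"
    if "{z} \<times> {t1..t2} \<subseteq> U" for z t1 t2 I
    using that by (intro has_integral_cong assms(2)) auto
  ultimately show ?thesis unfolding integral_of_form_def
    by (intro arg_cong2[where f = "(\<and>)"] iff_allI imp_cong refl) simp_all
qed

section \<open>Changing the space coordinate\<close>

text \<open>
  The inverse function theorem for \<open>(z, t) \<mapsto> (g (z, t), t)\<close> with a given inverse, whose continuity comes
  from Brouwer's theorem.
\<close>

lemma has_derivative_inverse_coordinate:
  fixes g k :: "real \<times> real \<Rightarrow> real"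
  assumes "open U" "(z, t) \<in> U" and cont: "continuous_on U g"
    and k_g: "\<And>z t. (z, t) \<in> U \<Longrightarrow> k (g (z, t), t) = z"
    and Dg: "(g has_derivative (\<lambda>d. a * fst d + b * snd d)) (at (z, t))" and "a \<noteq> 0"
  shows "((\<lambda>Q. (k Q, snd Q)) has_derivative (\<lambda>d. ((fst d - b * snd d) / a, snd d))) (at (g (z, t), t))"
proof -
  define \<Phi> where "\<Phi> = (\<lambda>P. (g P, snd P))"
  have D: "(\<Phi> has_derivative (\<lambda>d. (a * fst d + b * snd d, snd d))) (at (z, t))"
    unfolding \<Phi>_def by (intro has_derivative_Pair Dg) (auto intro!: derivative_eq_intros)
  have "continuous_on U \<Phi>" unfolding \<Phi>_def by (intro continuous_intros cont)
  moreover have "(\<lambda>Q. (k Q, snd Q)) (\<Phi> P) = P" if "P \<in> U" for P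
    using k_g that unfolding \<Phi>_def by (cases P) auto
  moreover have "(\<lambda>d. (a * fst d + b * snd d, snd d)) \<circ> (\<lambda>d. ((fst d - b * snd d) / a, snd d)) = id"
    using \<open>a \<noteq> 0\<close> by (auto simp: fun_eq_iff field_simps)
  ultimately have "((\<lambda>Q. (k Q, snd Q)) has_derivative (\<lambda>d. ((fst d - b * snd d) / a, snd d))) (at (\<Phi> (z, t)))"
    by (intro has_derivative_inverse_strong[OF assms(1,2) _ _ D])
  then show ?thesis by (simp add: \<Phi>_def)
qed

text \<open>
  A flow \<open>w\<close> on \<open>U\<close> and a flow \<open>w'\<close> on \<open>V\<close> that correspond via \<open>dy = A dz + B dt\<close>. From the material to the
  spatial coordinate \<open>A = v\<close> and \<open>B = u\<close>; in the opposite direction \<open>A = 1 / v\<close> and \<open>B = - u / v\<close>.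
\<close>

locale frame_change =
  fixes W :: "state set" and A B :: "state \<Rightarrow> real"
    and U :: "(real \<times> real) set" and w :: "real \<times> real \<Rightarrow> state" and g :: "real \<times> real \<Rightarrow> real"
    and V :: "(real \<times> real) set" and w' :: "real \<times> real \<Rightarrow> state" and k :: "real \<times> real \<Rightarrow> real"
  assumes open_U: "open U" and connected_U: "connected U"
    and open_V: "open V" and connected_V: "connected V"
    and g_into: "\<And>z t. (z, t) \<in> U \<Longrightarrow> (g (z, t), t) \<in> V"
    and k_g: "\<And>z t. (z, t) \<in> U \<Longrightarrow> k (g (z, t), t) = z"
    and flow_g: "\<And>z t. (z, t) \<in> U \<Longrightarrow> w' (g (z, t), t) = w (z, t)"
    and k_into: "\<And>y t. (y, t) \<in> V \<Longrightarrow> (k (y, t), t) \<in> U"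
    and g_k: "\<And>y t. (y, t) \<in> V \<Longrightarrow> g (k (y, t), t) = y"
    and flow_states: "\<And>P. P \<in> U \<Longrightarrow> w P \<in> W"
    and A_pos: "\<And>x. x \<in> W \<Longrightarrow> A x > 0"
    and A_continuous: "continuous_on W A" and B_continuous: "continuous_on W B"
    and form_g: "integral_of_form U (\<lambda>P. A (w P)) (\<lambda>P. B (w P)) g"
    and form_k: "integral_of_form V (\<lambda>P. 1 / A (w' P)) (\<lambda>P. - B (w' P) / A (w' P)) k"
begin

lemma flow_k: "(y, t) \<in> V \<Longrightarrow> w (k (y, t), t) = w' (y, t)"
  using flow_g[OF k_into] g_k by simp

lemma flow'_states: "P \<in> V \<Longrightarrow> w' P \<in> W"
  using flow_k k_into flow_states by (cases P) metis

text \<open>Solving \<open>dy = A dz + B dt\<close> for \<open>dz\<close>.\<close>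

lemma inverse_frame_change:
  "frame_change W (\<lambda>x. 1 / A x) (\<lambda>x. - B x / A x) V w' k U w g"
proof
  have nz: "A (w P) \<noteq> 0" if "P \<in> U" for P using A_pos[OF flow_states[OF that]] by simp
  show "integral_of_form U (\<lambda>P. 1 / (1 / A (w P))) (\<lambda>P. - (- B (w P) / A (w P)) / (1 / A (w P))) g"
    using form_g by (rule integral_of_form_cong[THEN iffD1, rotated 2]) (simp_all add: nz)
  show "continuous_on W (\<lambda>x. 1 / A x)" "continuous_on W (\<lambda>x. - B x / A x)"
    using A_pos by (intro continuous_intros A_continuous B_continuous; force)+
qed (fact open_U open_V connected_U connected_V g_into k_g k_into g_k form_k flow_k flow'_states | simp add: A_pos)+

lemma has_derivative_inverse_map:
  assumes "continuous_on U w" and P: "(z, t) \<in> U"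
  shows "((\<lambda>Q. (k Q, snd Q)) has_derivative
    (\<lambda>d. ((fst d - B (w (z, t)) * snd d) / A (w (z, t)), snd d))) (at (g (z, t), t))"
proof -
  have AB: "continuous_on U (\<lambda>P. A (w P))" "continuous_on U (\<lambda>P. B (w P))"
    using flow_states
    by (auto intro!: continuous_on_compose2[OF A_continuous assms(1)] continuous_on_compose2[OF B_continuous assms(1)])
  note Dg = integral_of_form_has_derivative[OF form_g open_U _ AB]
  have cont: "continuous_on U g"
    by (auto intro!: continuous_at_imp_continuous_on has_derivative_continuous[OF Dg])
  have nonzero: "A (w (z, t)) \<noteq> 0" using A_pos[OF flow_states[OF P]] by simp
  show ?thesis by (rule has_derivative_inverse_coordinate[OF open_U P cont k_g Dg[OF P] nonzero])
qed

lemma continuous_on_inverse_map: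
  assumes "continuous_on U w"
  shows "continuous_on V (\<lambda>Q. (k Q, snd Q))"
proof (intro continuous_at_imp_continuous_on ballI)
  fix Q assume "Q \<in> V"
  then obtain y t where Q: "Q = (y, t)" "(y, t) \<in> V" by (cases Q) auto
  from has_derivative_continuous[OF has_derivative_inverse_map[OF assms k_into[OF Q(2)]]]
  show "continuous (at Q) (\<lambda>Q. (k Q, snd Q))" by (simp add: g_k[OF Q(2)] Q(1))
qed

lemma C1_on_inverse_map:
  assumes "continuous_on U w"
  shows "C1_on (\<lambda>Q. (k Q, snd Q)) V"
proof (rule C1_onI)
  show "((\<lambda>Q. (k Q, snd Q)) has_derivative
      (\<lambda>d. ((fst d - B (w' Q) * snd d) / A (w' Q), snd d))) (at Q)" if "Q \<in> V" for Q
  proof -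
    obtain y t where Q: "Q = (y, t)" "(y, t) \<in> V" using \<open>Q \<in> V\<close> by (cases Q) auto
    show ?thesis using has_derivative_inverse_map[OF assms k_into[OF Q(2)]] by (simp add: Q g_k flow_k)
  qed
  have "continuous_on V (\<lambda>Q. w (k Q, snd Q))"
    by (rule continuous_on_compose2[OF assms continuous_on_inverse_map[OF assms]]) (auto intro: k_into)
  then have w': "continuous_on V w'"
    by (rule continuous_on_eq) (auto simp: flow_k)
  have "continuous_on V (\<lambda>P. A (w' P))" "continuous_on V (\<lambda>P. B (w' P))"
    using flow'_states
    by (auto intro!: continuous_on_compose2[OF A_continuous w'] continuous_on_compose2[OF B_continuous w'])
  moreover have "A (w' Q) \<noteq> 0" if "Q \<in> V" for Q using A_pos[OF flow'_states[OF that]] by simp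
  ultimately show "continuous_on V (\<lambda>Q. ((fst d - B (w' Q) * snd d) / A (w' Q), snd d))" for d :: "real \<times> real"
    by (intro continuous_intros) auto
qed

lemma C1_on_pullback:
  fixes f :: "real \<times> real \<Rightarrow> 'a::real_normed_vector"
  assumes "continuous_on U w" "C1_on f U"
  shows "C1_on (\<lambda>Q. f (k Q, snd Q)) V"
  using C1_on_compose[OF assms(2) C1_on_inverse_map[OF assms(1)]] k_into by auto

lemma C1_on_flow:
  assumes "C1_on w U"
  shows "C1_on w' V"
  by (rule C1_on_cong[OF open_V C1_on_pullback[OF C1_on_continuous_on[OF assms] assms]]) (auto simp: flow_k)

text \<open>The chain rule: \<open>\<partial>\<^sub>y = A\<inverse> \<partial>\<^sub>z\<close> and \<open>\<partial>\<^sub>t\<bar>\<^sub>y = \<partial>\<^sub>t\<bar>\<^sub>z - (B / A) \<partial>\<^sub>z\<close>.\<close>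

lemma has_derivative_flow:
  assumes "C1_on w U" and P: "(z, t) \<in> U"
  shows "(w' has_derivative (\<lambda>d. frechet_derivative w (at (z, t))
    ((fst d - B (w (z, t)) * snd d) / A (w (z, t)), snd d))) (at (g (z, t), t))"
proof -
  have "(w has_derivative frechet_derivative w (at (z, t))) (at ((\<lambda>Q. (k Q, snd Q)) (g (z, t), t)))"
    using C1_on_has_derivative[OF assms] by (simp add: k_g P)
  from has_derivative_compose[OF has_derivative_inverse_map[OF C1_on_continuous_on[OF assms(1)] P] this]
  show ?thesis
    by (rule has_derivative_transform_within_open[OF _ open_V g_into[OF P]]) (auto simp: flow_k)
qed

lemma C1_on_flow_iff: "C1_on w U \<longleftrightarrow> C1_on w' V"
  using C1_on_flow frame_change.C1_on_flow[OF inverse_frame_change] by blast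

lemma parametrisation:
  assumes "continuous_on U w" "\<exists>\<phi>. C1_on \<phi> U \<and> (\<forall>P\<in>U. \<phi> P \<in> J \<and> w P = \<gamma> (\<phi> P))"
  shows "\<exists>\<phi>. C1_on \<phi> V \<and> (\<forall>Q\<in>V. \<phi> Q \<in> J \<and> w' Q = \<gamma> (\<phi> Q))"
proof -
  obtain \<phi> where \<phi>: "C1_on \<phi> U" "\<forall>P\<in>U. \<phi> P \<in> J \<and> w P = \<gamma> (\<phi> P)" using assms(2) by blast
  have "(\<forall>Q\<in>V. \<phi> (k Q, snd Q) \<in> J \<and> w' Q = \<gamma> (\<phi> (k Q, snd Q)))"
    using \<phi>(2) k_into flow_k by fastforce
  with C1_on_pullback[OF assms(1) \<phi>(1)] show ?thesis by blast
qed

end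

section \<open>Piecewise linear changes of coordinate\<close>

text \<open>
  Across a straight front \<open>z = z0 + \<sigma> t\<close> separating two constant states the form \<open>A dz + B dt\<close> has
  constant coefficients on either side. It is closed exactly if \<open>\<sigma> A + B\<close> takes the same value \<open>s\<close>
  on both sides, and this map is then its integral, carrying the front to \<open>y = y0 + s t\<close>.
\<close>

definition kinked_map :: "real \<Rightarrow> real \<Rightarrow> real \<Rightarrow> real \<Rightarrow> real \<Rightarrow> real \<Rightarrow> real \<times> real \<Rightarrow> real" where
  "kinked_map z0 \<sigma> y0 s al ar P =
    y0 + s * snd P + al * min 0 (fst P - z0 - \<sigma> * snd P) + ar * max 0 (fst P - z0 - \<sigma> * snd P)"

lemma kinked_map_left: "z \<le> z0 + \<sigma> * t \<Longrightarrow> kinked_map z0 \<sigma> y0 s al ar (z, t) = y0 + s * t + al * (z - z0 - \<sigma> * t)"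
  and kinked_map_right: "z0 + \<sigma> * t \<le> z \<Longrightarrow> kinked_map z0 \<sigma> y0 s al ar (z, t) = y0 + s * t + ar * (z - z0 - \<sigma> * t)"
  by (auto simp: kinked_map_def min_def max_def)

lemma continuous_on_kinked_map: "continuous_on S (kinked_map z0 \<sigma> y0 s al ar)"
  unfolding kinked_map_def by (intro continuous_intros)

lemma kinked_map_side:
  assumes "al > 0" "ar > 0"
  shows "kinked_map z0 \<sigma> y0 s al ar (z, t) < y0 + s * t \<longleftrightarrow> z < z0 + \<sigma> * t"
proof (cases "z < z0 + \<sigma> * t")
  case True
  then have "al * (z - z0 - \<sigma> * t) < 0" using assms(1) by (intro mult_pos_neg) auto
  then show ?thesis using True by (simp add: kinked_map_left)
next
  case False
  then have "ar * (z - z0 - \<sigma> * t) \<ge> 0" using assms(2) by (intro mult_nonneg_nonneg) auto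
  then show ?thesis using False by (simp add: kinked_map_right)
qed

lemma kinked_map_inverse:
  assumes "al > 0" "ar > 0"
  shows "kinked_map y0 s z0 \<sigma> (1 / al) (1 / ar) (kinked_map z0 \<sigma> y0 s al ar (z, t), t) = z"
proof (cases "z < z0 + \<sigma> * t")
  case True
  then have "kinked_map z0 \<sigma> y0 s al ar (z, t) \<le> y0 + s * t"
    using kinked_map_side[OF assms] by (simp add: less_imp_le)
  from kinked_map_left[OF this] True assms show ?thesis by (simp add: kinked_map_left)
next
  case False
  then have "y0 + s * t \<le> kinked_map z0 \<sigma> y0 s al ar (z, t)"
    using kinked_map_side[OF assms, of z0 \<sigma> y0 s z t] by simp
  from kinked_map_right[OF this] False assms show ?thesis by (simp add: kinked_map_right)
qed

lemma integral_of_form_kinked_map: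
  assumes l: "s = bl + \<sigma> * al" and r: "s = br + \<sigma> * ar"
  shows "integral_of_form S (\<lambda>(z, t). if z < z0 + \<sigma> * t then al else ar)
    (\<lambda>(z, t). if z < z0 + \<sigma> * t then bl else br) (kinked_map z0 \<sigma> y0 s al ar)"
  unfolding integral_of_form_def
proof (intro conjI allI impI; elim conjE)
  let ?g = "kinked_map z0 \<sigma> y0 s al ar"
  have cont: "continuous_on X (\<lambda>x. ?g (x, t))" "continuous_on X (\<lambda>x. ?g (z, x))" for X z t
    unfolding kinked_map_def by (intro continuous_intros)+
  have sides: "open {x. z < c + \<sigma> * x}" "open {x. z > c + \<sigma> * x}" for c z :: real
    by (intro open_Collect_less continuous_intros)+
  {
    fix z1 z2 t :: real assume "z1 \<le> z2"
    show "((\<lambda>\<zeta>. case (\<zeta>, t) of (z, t) \<Rightarrow> if z < z0 + \<sigma> * t then al else ar) has_integral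
        (?g (z2, t) - ?g (z1, t))) {z1..z2}"
    proof (rule fundamental_theorem_of_calculus_interior_strong[where S = "{z0 + \<sigma> * t}"])
      fix x assume "x \<in> {z1<..<z2} - {z0 + \<sigma> * t}"
      then consider "x < z0 + \<sigma> * t" | "x > z0 + \<sigma> * t" by fastforce
      then show "((\<lambda>\<zeta>. ?g (\<zeta>, t)) has_vector_derivative
          (case (x, t) of (z, t) \<Rightarrow> if z < z0 + \<sigma> * t then al else ar)) (at x)"
      proof cases
        case 1
        have "((\<lambda>\<zeta>. y0 + s * t + al * (\<zeta> - z0 - \<sigma> * t)) has_vector_derivative al) (at x)"
          by (auto intro!: derivative_eq_intros simp: has_real_derivative_iff_has_vector_derivative[symmetric])
        then have "((\<lambda>\<zeta>. ?g (\<zeta>, t)) has_vector_derivative al) (at x)"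
          by (rule has_vector_derivative_transform_within_open[of _ _ _ "{..<z0 + \<sigma> * t}"])
            (use 1 in \<open>auto simp: kinked_map_left\<close>)
        then show ?thesis using 1 by simp
      next
        case 2
        have "((\<lambda>\<zeta>. y0 + s * t + ar * (\<zeta> - z0 - \<sigma> * t)) has_vector_derivative ar) (at x)"
          by (auto intro!: derivative_eq_intros simp: has_real_derivative_iff_has_vector_derivative[symmetric])
        then have "((\<lambda>\<zeta>. ?g (\<zeta>, t)) has_vector_derivative ar) (at x)"
          by (rule has_vector_derivative_transform_within_open[of _ _ _ "{z0 + \<sigma> * t<..}"])
            (use 2 in \<open>auto simp: kinked_map_right\<close>)
        then show ?thesis using 2 by simp
      qed
    qed (use \<open>z1 \<le> z2\<close> cont in auto)
  next
    fix z t1 t2 :: real assume "t1 \<le> t2"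
    have dl: "((\<lambda>\<tau>. y0 + s * \<tau> + al * (z - z0 - \<sigma> * \<tau>)) has_vector_derivative bl) (at x)" for x
      using l by (auto intro!: derivative_eq_intros simp: has_real_derivative_iff_has_vector_derivative[symmetric] algebra_simps)
    have dr: "((\<lambda>\<tau>. y0 + s * \<tau> + ar * (z - z0 - \<sigma> * \<tau>)) has_vector_derivative br) (at x)" for x
      using r by (auto intro!: derivative_eq_intros simp: has_real_derivative_iff_has_vector_derivative[symmetric] algebra_simps)
    \<comment> \<open>A vertical line meets a moving front at time \<open>(z - z0) / \<sigma>\<close> only. A stationary front may contain the whole line,
      and then the coefficients and the map are those of the right side throughout.\<close>
    show "((\<lambda>\<tau>. case (z, \<tau>) of (z, t) \<Rightarrow> if z < z0 + \<sigma> * t then bl else br) has_integral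
        (?g (z, t2) - ?g (z, t1))) {t1..t2}"
    proof (rule fundamental_theorem_of_calculus_interior_strong[where S = "{(z - z0) / \<sigma>}"])
      fix x assume x: "x \<in> {t1<..<t2} - {(z - z0) / \<sigma>}"
      consider "z < z0 + \<sigma> * x" | "z > z0 + \<sigma> * x" | "\<sigma> = 0" "z = z0"
        using x by (cases "\<sigma> = 0"; cases z "z0 + \<sigma> * x" rule: linorder_cases) (auto simp: field_simps)
      then show "((\<lambda>\<tau>. ?g (z, \<tau>)) has_vector_derivative
          (case (z, x) of (z, t) \<Rightarrow> if z < z0 + \<sigma> * t then bl else br)) (at x)"
      proof cases
        case 1
        have "((\<lambda>\<tau>. ?g (z, \<tau>)) has_vector_derivative bl) (at x)"
          by (rule has_vector_derivative_transform_within_open[OF dl sides(1)[of z z0]])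
            (use 1 in \<open>auto simp: kinked_map_left\<close>)
        then show ?thesis using 1 by simp
      next
        case 2
        have "((\<lambda>\<tau>. ?g (z, \<tau>)) has_vector_derivative br) (at x)"
          by (rule has_vector_derivative_transform_within_open[OF dr sides(2)[of z0 z]])
            (use 2 in \<open>auto simp: kinked_map_right\<close>)
        then show ?thesis using 2 by simp
      next
        case 3
        have "((\<lambda>\<tau>. ?g (z, \<tau>)) has_vector_derivative br) (at x)"
          by (rule has_vector_derivative_transform_within_open[OF dr open_UNIV])
            (use 3 in \<open>auto simp: kinked_map_right\<close>)
        then show ?thesis using 3 by simp
      qed
    qed (use \<open>t1 \<le> t2\<close> cont in auto)
  }
qed

section \<open>Fronts under a change of frame\<close>

context frame_change
begin

text \<open>
  The form has an explicit integral, so the coordinate map agrees with it up to a constant on all of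
  \<open>U\<close>, even where horizontal lines meet \<open>U\<close> in several pieces; the constant shifts the image front.
\<close>

lemma jump_flow:
  assumes lr: "wl \<in> W" "wr \<in> W" and s: "s = B wl + \<sigma> * A wl" "s = B wr + \<sigma> * A wr"
    and w: "\<And>z t. (z, t) \<in> U \<Longrightarrow> w (z, t) = (if z < z0 + \<sigma> * t then wl else wr)"
  shows "\<exists>y0. \<forall>y t. (y, t) \<in> V \<longrightarrow> w' (y, t) = (if y < y0 + s * t then wl else wr)"
proof -
  let ?g = "kinked_map z0 \<sigma> 0 s (A wl) (A wr)"
  have "integral_of_form U (\<lambda>P. A (w P)) (\<lambda>P. B (w P)) ?g"
    using integral_of_form_kinked_map[OF s, of U z0 0]
    by (rule integral_of_form_cong[THEN iffD1, rotated 2]) (auto simp: w)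
  from integral_of_form_unique[OF open_U connected_U form_g this]
  obtain c where c: "\<And>P. P \<in> U \<Longrightarrow> g P = ?g P + c" by blast
  have "w' (y, t) = (if y < c + s * t then wl else wr)" if V: "(y, t) \<in> V" for y t
  proof -
    have "y = ?g (k (y, t), t) + c" using c[OF k_into[OF V]] g_k[OF V] by simp
    then have "y < c + s * t \<longleftrightarrow> k (y, t) < z0 + \<sigma> * t"
      using kinked_map_side[OF A_pos[OF lr(1)] A_pos[OF lr(2)], of z0 \<sigma> 0 s "k (y, t)" t] by auto
    then show ?thesis using w[OF k_into[OF V]] flow_k[OF V] by simp
  qed
  then show ?thesis by blast
qed

lemma coefficients_near_front:
  assumes lim: "(w \<longlongrightarrow> x) (at (z, t) within S)" and "x \<in> W" "(z, t) \<in> U" "(z, t) \<notin> S" "e > 0"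
  obtains \<delta> where "\<delta> > 0"
    and "\<And>\<zeta> \<tau>. \<bar>\<zeta> - z\<bar> < \<delta> \<Longrightarrow> \<bar>\<tau> - t\<bar> < \<delta> \<Longrightarrow> (\<zeta>, \<tau>) \<in> U"
    and "\<And>\<zeta> \<tau>. \<bar>\<zeta> - z\<bar> < \<delta> \<Longrightarrow> \<bar>\<tau> - t\<bar> < \<delta> \<Longrightarrow> (\<zeta>, \<tau>) \<in> S \<Longrightarrow>
      \<bar>A (w (\<zeta>, \<tau>)) - A x\<bar> \<le> e \<and> \<bar>B (w (\<zeta>, \<tau>)) - B x\<bar> \<le> e"
proof -
  have inU: "eventually (\<lambda>P. P \<in> U) (nhds (z, t))"
    using open_U assms(3) by (rule eventually_nhds_in_open)
  then have inW: "eventually (\<lambda>P. w P \<in> W) (at (z, t) within S)"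
    by (auto simp: eventually_at_filter flow_states elim: eventually_mono)
  have "eventually (\<lambda>P. dist (A (w P)) (A x) < e) (at (z, t) within S)"
    "eventually (\<lambda>P. dist (B (w P)) (B x) < e) (at (z, t) within S)"
    using continuous_on_tendsto_compose[OF A_continuous lim \<open>x \<in> W\<close> inW]
      continuous_on_tendsto_compose[OF B_continuous lim \<open>x \<in> W\<close> inW] \<open>e > 0\<close>
    by (auto dest: tendstoD)
  then have "eventually (\<lambda>P. P \<in> S \<longrightarrow> \<bar>A (w P) - A x\<bar> \<le> e \<and> \<bar>B (w P) - B x\<bar> \<le> e) (nhds (z, t))"
    unfolding eventually_at_filter by eventually_elim (use assms(4) in \<open>auto simp: dist_real_def\<close>)
  with inU have "eventually (\<lambda>P. P \<in> U \<and> (P \<in> S \<longrightarrow> \<bar>A (w P) - A x\<bar> \<le> e \<and> \<bar>B (w P) - B x\<bar> \<le> e)) (nhds (z, t))"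
    by eventually_elim auto
  then show ?thesis using that unfolding eventually_nhds_box by metis
qed

text \<open>
  The position of the front in the new coordinate is found by integrating the form along a path
  that leaves the front, runs through the left state at constant \<open>z\<close>, and comes back: on the front
  itself the flow may take arbitrary values, and if the front is stationary these fill a segment.
  The path stays clear of the front because the front moves at speed close to \<open>\<sigma>\<close>.
\<close>

lemma front_velocity:
  assumes U: "(X t, t) \<in> U" and X: "(X has_real_derivative \<sigma>) (at t)"
    and left: "(w \<longlongrightarrow> wl) (at (X t, t) within {(z, \<tau>). z < X \<tau>})" and "wl \<in> W"
  shows "((\<lambda>\<tau>. g (X \<tau>, \<tau>)) has_real_derivative B wl + \<sigma> * A wl) (at t)"
  unfolding has_field_derivative_def has_derivative_at_alt
proof (intro conjI allI impI bounded_linear_mult_right)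
  fix e :: real assume "e > 0"
  \<comment> \<open>The path leaves the front by the distance \<open>M \<bar>\<tau> - t\<bar>\<close>, more than the front can move back in
    that time. Its three legs have total length at most \<open>(3 M + 1) \<bar>\<tau> - t\<bar>\<close>; the remaining \<open>A wl\<close> in \<open>C\<close>
    accounts for the deviation of the front from its tangent.\<close>
  define M where "M = \<bar>\<sigma>\<bar> + 1"
  define C where "C = 3 * M + 1 + A wl"
  define e1 where "e1 = min (1 / 2) (e / C)"
  have "A wl > 0" using A_pos \<open>wl \<in> W\<close> by blast
  then have "M \<ge> 1" "C > 0" by (auto simp: M_def C_def)
  then have e1: "0 < e1" "e1 \<le> 1 / 2" "e1 * C \<le> e"
    using \<open>e > 0\<close> by (auto simp: e1_def min_def field_simps)
  obtain \<delta>1 where "\<delta>1 > 0" and box: "\<And>\<zeta> \<tau>. \<bar>\<zeta> - X t\<bar> < \<delta>1 \<Longrightarrow> \<bar>\<tau> - t\<bar> < \<delta>1 \<Longrightarrow> (\<zeta>, \<tau>) \<in> U"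
    and near: "\<And>\<zeta> \<tau>. \<bar>\<zeta> - X t\<bar> < \<delta>1 \<Longrightarrow> \<bar>\<tau> - t\<bar> < \<delta>1 \<Longrightarrow> \<zeta> < X \<tau> \<Longrightarrow>
      \<bar>A (w (\<zeta>, \<tau>)) - A wl\<bar> \<le> e1 \<and> \<bar>B (w (\<zeta>, \<tau>)) - B wl\<bar> \<le> e1"
    using coefficients_near_front[OF left \<open>wl \<in> W\<close> U _ \<open>e1 > 0\<close>] by auto
  obtain \<delta>2 where "\<delta>2 > 0"
    and lin: "\<And>\<tau>. \<bar>\<tau> - t\<bar> < \<delta>2 \<Longrightarrow> \<bar>X \<tau> - X t - \<sigma> * (\<tau> - t)\<bar> \<le> e1 * \<bar>\<tau> - t\<bar>"
    using X e1(1) unfolding has_field_derivative_def has_derivative_at_alt real_norm_def by blast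
  define \<delta> where "\<delta> = min \<delta>2 (\<delta>1 / M)"
  have "\<delta> > 0" using \<open>\<delta>1 > 0\<close> \<open>\<delta>2 > 0\<close> \<open>M \<ge> 1\<close> by (simp add: \<delta>_def)
  moreover have "\<bar>g (X \<tau>, \<tau>) - g (X t, t) - (B wl + \<sigma> * A wl) * (\<tau> - t)\<bar> \<le> e * \<bar>\<tau> - t\<bar>"
    if small: "\<bar>\<tau> - t\<bar> < \<delta>" for \<tau>
  proof (cases "\<tau> = t")
    case False
    define r where "r = \<bar>\<tau> - t\<bar>"
    have "r > 0" using False by (simp add: r_def)
    have r: "r < \<delta>2" "M * r < \<delta>1" using small \<open>M \<ge> 1\<close> by (auto simp: r_def \<delta>_def field_simps)
    have "r \<le> M * r" using \<open>M \<ge> 1\<close> \<open>r > 0\<close> by simp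
    have seg: "\<bar>\<tau>' - t\<bar> \<le> r" if "\<tau>' \<in> closed_segment t \<tau>" for \<tau>'
      using closed_segment_abs_bound[OF that] by (auto simp: r_def)
    define z1 where "z1 = X t - M * r"
    have Xbound: "\<bar>X \<tau>' - X t\<bar> < M * r" if "\<bar>\<tau>' - t\<bar> \<le> r" for \<tau>'
    proof -
      have "\<bar>X \<tau>' - X t\<bar> \<le> \<bar>\<sigma> * (\<tau>' - t)\<bar> + e1 * \<bar>\<tau>' - t\<bar>"
        using lin[of \<tau>'] that r by linarith
      also have "\<dots> = (\<bar>\<sigma>\<bar> + e1) * \<bar>\<tau>' - t\<bar>" by (simp add: abs_mult distrib_right)
      also have "\<dots> \<le> (\<bar>\<sigma>\<bar> + e1) * r" using that e1 by (intro mult_left_mono) auto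
      also have "\<dots> < M * r" using e1 \<open>r > 0\<close> by (intro mult_strict_right_mono) (auto simp: M_def)
      finally show ?thesis .
    qed
    \<comment> \<open>The endpoint on the front is exempt from the estimate, here and on the way back.\<close>
    have out: "\<bar>g (z1, t) - g (X t, t) - A wl * (z1 - X t)\<bar> \<le> e1 * \<bar>z1 - X t\<bar>"
    proof (rule integral_of_form_horizontal[OF form_g, where N = "{X t}"])
      have *: "\<bar>\<zeta> - X t\<bar> < \<delta>1" "\<zeta> \<le> X t" if "\<zeta> \<in> closed_segment (X t) z1" for \<zeta>
        using that \<open>r > 0\<close> \<open>M \<ge> 1\<close> r \<open>r \<le> M * r\<close> by (auto simp: closed_segment_eq_real_ivl z1_def split: if_splits)
      show "closed_segment (X t) z1 \<times> {t} \<subseteq> U" using box * \<open>\<delta>1 > 0\<close> by auto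
      show "\<bar>A (w (\<zeta>, t)) - A wl\<bar> \<le> e1" if "\<zeta> \<in> closed_segment (X t) z1" "\<zeta> \<notin> {X t}" for \<zeta>
        using near[of \<zeta> t] *[OF that(1)] that(2) \<open>\<delta>1 > 0\<close> by simp
    qed (use e1 in auto)
    have up: "\<bar>g (z1, \<tau>) - g (z1, t) - B wl * (\<tau> - t)\<bar> \<le> e1 * \<bar>\<tau> - t\<bar>"
    proof (rule integral_of_form_vertical[OF form_g, where N = "{}"])
      have *: "\<bar>z1 - X t\<bar> < \<delta>1" using r \<open>r > 0\<close> \<open>M \<ge> 1\<close> by (simp add: z1_def)
      show "{z1} \<times> closed_segment t \<tau> \<subseteq> U" using box[OF *] seg r \<open>r \<le> M * r\<close> by fastforce
      show "\<bar>B (w (z1, \<tau>')) - B wl\<bar> \<le> e1" if "\<tau>' \<in> closed_segment t \<tau>" for \<tau>'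
        using near[OF *, of \<tau>'] seg[OF that(1)] r \<open>r \<le> M * r\<close> Xbound[of \<tau>'] by (simp add: z1_def abs_if split: if_splits)
    qed (use e1 in auto)
    have way_back: "\<bar>g (X \<tau>, \<tau>) - g (z1, \<tau>) - A wl * (X \<tau> - z1)\<bar> \<le> e1 * \<bar>X \<tau> - z1\<bar>"
    proof (rule integral_of_form_horizontal[OF form_g, where N = "{X \<tau>}"])
      have X\<tau>: "\<bar>X \<tau> - X t\<bar> < M * r" using Xbound[of \<tau>] by (simp add: r_def)
      then have "z1 < X \<tau>" by (simp add: z1_def abs_if split: if_splits)
      have *: "\<bar>\<zeta> - X t\<bar> < \<delta>1" "\<zeta> \<le> X \<tau>" if "\<zeta> \<in> closed_segment z1 (X \<tau>)" for \<zeta>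
        using closed_segment_abs_bound[OF that, of "X t" "M * r"] X\<tau> r that \<open>r > 0\<close> \<open>M \<ge> 1\<close> \<open>z1 < X \<tau>\<close>
        by (auto simp: z1_def closed_segment_eq_real_ivl)
      have "\<bar>\<tau> - t\<bar> < \<delta>1" using r \<open>r \<le> M * r\<close> by (simp add: r_def)
      then show "closed_segment z1 (X \<tau>) \<times> {\<tau>} \<subseteq> U" using box * by auto
      show "\<bar>A (w (\<zeta>, \<tau>)) - A wl\<bar> \<le> e1" if "\<zeta> \<in> closed_segment z1 (X \<tau>)" "\<zeta> \<notin> {X \<tau>}" for \<zeta>
        using near[of \<zeta> \<tau>] *[OF that(1)] that(2) \<open>\<bar>\<tau> - t\<bar> < \<delta>1\<close> by simp
    qed (use e1 in auto)
    have X\<tau>: "\<bar>X \<tau> - X t\<bar> < M * r" using Xbound[of \<tau>] by (simp add: r_def)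
    have dist1: "\<bar>z1 - X t\<bar> = M * r" using \<open>r > 0\<close> \<open>M \<ge> 1\<close> by (simp add: z1_def)
    have "\<bar>X \<tau> - z1\<bar> \<le> 2 * (M * r)" using X\<tau> by (simp add: z1_def abs_if split: if_splits)
    then have dist2: "e1 * \<bar>X \<tau> - z1\<bar> \<le> e1 * (2 * (M * r))" using e1 by (intro mult_left_mono) auto
    have "\<bar>A wl * (X \<tau> - X t - \<sigma> * (\<tau> - t))\<bar> \<le> A wl * (e1 * r)"
      using lin[of \<tau>] r \<open>A wl > 0\<close> by (simp add: abs_mult r_def)
    moreover have "g (X \<tau>, \<tau>) - g (X t, t) - (B wl + \<sigma> * A wl) * (\<tau> - t) =
      (g (z1, t) - g (X t, t) - A wl * (z1 - X t)) + (g (z1, \<tau>) - g (z1, t) - B wl * (\<tau> - t)) +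
      (g (X \<tau>, \<tau>) - g (z1, \<tau>) - A wl * (X \<tau> - z1)) + A wl * (X \<tau> - X t - \<sigma> * (\<tau> - t))"
      by (simp add: algebra_simps)
    moreover have "\<bar>G\<bar> \<le> x1 + x2 + x3 + x4"
      if "G = y1 + y2 + y3 + y4" "\<bar>y1\<bar> \<le> x1" "\<bar>y2\<bar> \<le> x2" "\<bar>y3\<bar> \<le> x3" "\<bar>y4\<bar> \<le> x4"
      for G x1 x2 x3 x4 y1 y2 y3 y4 :: real
      using that by linarith
    ultimately have "\<bar>g (X \<tau>, \<tau>) - g (X t, t) - (B wl + \<sigma> * A wl) * (\<tau> - t)\<bar>
        \<le> e1 * \<bar>z1 - X t\<bar> + e1 * \<bar>\<tau> - t\<bar> + e1 * \<bar>X \<tau> - z1\<bar> + A wl * (e1 * r)"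
      using out up way_back by blast
    also have "\<dots> \<le> e1 * (M * r) + e1 * r + e1 * (2 * (M * r)) + A wl * (e1 * r)"
      unfolding dist1 r_def[symmetric] by (intro add_mono order_refl dist2)
    also have "\<dots> = e1 * C * r" by (simp add: C_def algebra_simps)
    also have "\<dots> \<le> e * r" using e1 \<open>r > 0\<close> by (intro mult_right_mono) auto
    finally show ?thesis by (simp add: r_def)
  qed simp
  ultimately show "\<exists>d>0. \<forall>\<tau>. norm (\<tau> - t) < d \<longrightarrow>
      norm (g (X \<tau>, \<tau>) - g (X t, t) - (B wl + \<sigma> * A wl) * (\<tau> - t)) \<le> e * norm (\<tau> - t)"
    unfolding real_norm_def by blast
qed

text \<open>
  Here \<open>\<epsilon>\<close> selects the left (\<open>-1\<close>) or right (\<open>1\<close>) side of the front. As \<open>A\<close> stays away from zero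
  there, a point at distance \<open>d\<close> of the image front comes from a point at distance \<open>O(d)\<close> on the same
  side of the front. This replaces continuity of the inverse map, of which nothing is known where the
  flow is discontinuous.
\<close>

lemma front_preimage:
  assumes \<epsilon>: "\<epsilon> = 1 \<or> \<epsilon> = - 1" and U: "(X t, t) \<in> U"
    and X: "isCont X t" and Y: "isCont (\<lambda>\<tau>. g (X \<tau>, \<tau>)) t"
    and lim: "(w \<longlongrightarrow> x) (at (X t, t) within {(z, \<tau>). 0 < \<epsilon> * (z - X \<tau>)})" and "x \<in> W"
  obtains \<delta> c where "\<delta> > 0"
    and "\<And>y \<tau>. \<bar>y - g (X t, t)\<bar> < \<delta> \<Longrightarrow> \<bar>\<tau> - t\<bar> < \<delta> \<Longrightarrow> 0 < \<epsilon> * (y - g (X \<tau>, \<tau>)) \<Longrightarrow>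
      0 < \<epsilon> * (k (y, \<tau>) - X \<tau>) \<and> \<bar>k (y, \<tau>) - X \<tau>\<bar> \<le> c * \<bar>y - g (X \<tau>, \<tau>)\<bar>"
proof -
  define a where "a = A x"
  have "a > 0" using A_pos \<open>x \<in> W\<close> by (simp add: a_def)
  then have "a / 2 > 0" by simp
  obtain \<delta>1 where "\<delta>1 > 0" and box: "\<And>\<zeta> \<tau>. \<bar>\<zeta> - X t\<bar> < \<delta>1 \<Longrightarrow> \<bar>\<tau> - t\<bar> < \<delta>1 \<Longrightarrow> (\<zeta>, \<tau>) \<in> U"
    and near': "\<And>\<zeta> \<tau>. \<bar>\<zeta> - X t\<bar> < \<delta>1 \<Longrightarrow> \<bar>\<tau> - t\<bar> < \<delta>1 \<Longrightarrow> (\<zeta>, \<tau>) \<in> {(z, \<tau>). 0 < \<epsilon> * (z - X \<tau>)} \<Longrightarrow>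
      \<bar>A (w (\<zeta>, \<tau>)) - A x\<bar> \<le> a / 2 \<and> \<bar>B (w (\<zeta>, \<tau>)) - B x\<bar> \<le> a / 2"
    by (rule coefficients_near_front[OF lim \<open>x \<in> W\<close> U _ \<open>a / 2 > 0\<close>]) auto
  have near: "\<bar>A (w (\<zeta>, \<tau>)) - a\<bar> \<le> a / 2"
    if "\<bar>\<zeta> - X t\<bar> < \<delta>1" "\<bar>\<tau> - t\<bar> < \<delta>1" "0 < \<epsilon> * (\<zeta> - X \<tau>)" for \<zeta> \<tau>
    using near'[OF that(1,2)] that(3) unfolding a_def by simp
  obtain \<delta>2 where "\<delta>2 > 0" and X2: "\<And>\<tau>. \<bar>\<tau> - t\<bar> < \<delta>2 \<Longrightarrow> \<bar>X \<tau> - X t\<bar> < \<delta>1 / 2"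
    using X \<open>\<delta>1 > 0\<close> unfolding continuous_at_eps_delta dist_real_def by (meson half_gt_zero)
  have "a * \<delta>1 / 8 > 0" using \<open>a > 0\<close> \<open>\<delta>1 > 0\<close> by simp
  then obtain \<delta>3 where "\<delta>3 > 0" and Y3: "\<And>\<tau>. \<bar>\<tau> - t\<bar> < \<delta>3 \<Longrightarrow> \<bar>g (X \<tau>, \<tau>) - g (X t, t)\<bar> < a * \<delta>1 / 8"
    using Y unfolding continuous_at_eps_delta dist_real_def by meson
  define \<delta> where "\<delta> = min (min \<delta>1 \<delta>2) (min \<delta>3 (a * \<delta>1 / 8))"
  have "\<delta> > 0" using \<open>\<delta>1 > 0\<close> \<open>\<delta>2 > 0\<close> \<open>\<delta>3 > 0\<close> \<open>a > 0\<close> by (simp add: \<delta>_def)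
  moreover have "0 < \<epsilon> * (k (y, \<tau>) - X \<tau>) \<and> \<bar>k (y, \<tau>) - X \<tau>\<bar> \<le> 2 / a * \<bar>y - g (X \<tau>, \<tau>)\<bar>"
    if y: "\<bar>y - g (X t, t)\<bar> < \<delta>" and \<tau>: "\<bar>\<tau> - t\<bar> < \<delta>" and side: "0 < \<epsilon> * (y - g (X \<tau>, \<tau>))" for y \<tau>
  proof -
    \<comment> \<open>As \<open>A \<ge> a / 2\<close> on this side, the image of a segment of length \<open>d\<close> from the front reaches \<open>y\<close>.\<close>
    define d where "d = 2 / a * \<bar>y - g (X \<tau>, \<tau>)\<bar>"
    have "\<bar>y - g (X \<tau>, \<tau>)\<bar> < a * \<delta>1 / 4"
      using y Y3[of \<tau>] \<tau> unfolding \<delta>_def by linarith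
    then have d: "0 \<le> d" "d < \<delta>1 / 2" using \<open>a > 0\<close> by (auto simp: d_def field_simps)
    have \<tau>1: "\<bar>\<tau> - t\<bar> < \<delta>1" and X\<tau>: "\<bar>X \<tau> - X t\<bar> < \<delta>1 / 2" using \<tau> X2 by (auto simp: \<delta>_def)
    have inU: "(\<zeta>, \<tau>) \<in> U" if "\<bar>\<zeta> - X \<tau>\<bar> \<le> d" for \<zeta>
      using that d X\<tau> by (intro box \<tau>1) linarith
    have \<epsilon>2: "\<epsilon> * \<epsilon> = 1" "\<bar>\<epsilon>\<bar> = 1" using \<epsilon> by auto
    have "\<bar>g (X \<tau> + \<epsilon> * d, \<tau>) - g (X \<tau>, \<tau>) - a * (X \<tau> + \<epsilon> * d - X \<tau>)\<bar> \<le> a / 2 * \<bar>X \<tau> + \<epsilon> * d - X \<tau>\<bar>"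
    proof (rule integral_of_form_horizontal[OF form_g, where N = "{X \<tau>}"])
      have *: "\<bar>\<zeta> - X \<tau>\<bar> \<le> d" "0 \<le> \<epsilon> * (\<zeta> - X \<tau>)" if "\<zeta> \<in> closed_segment (X \<tau>) (X \<tau> + \<epsilon> * d)" for \<zeta>
        using that d \<epsilon> by (auto simp: closed_segment_eq_real_ivl split: if_splits)
      show "closed_segment (X \<tau>) (X \<tau> + \<epsilon> * d) \<times> {\<tau>} \<subseteq> U" using *(1) inU by auto
      show "\<bar>A (w (\<zeta>, \<tau>)) - a\<bar> \<le> a / 2" if "\<zeta> \<in> closed_segment (X \<tau>) (X \<tau> + \<epsilon> * d)" "\<zeta> \<notin> {X \<tau>}" for \<zeta>
      proof (rule near[OF _ \<tau>1])
        show "\<bar>\<zeta> - X t\<bar> < \<delta>1" using *(1)[OF that(1)] d X\<tau> by linarith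
        show "0 < \<epsilon> * (\<zeta> - X \<tau>)" using *(2)[OF that(1)] that(2) \<epsilon> by auto
      qed
    qed (use \<open>a > 0\<close> in auto)
    then have "\<bar>g (X \<tau> + \<epsilon> * d, \<tau>) - g (X \<tau>, \<tau>) - \<epsilon> * (a * d)\<bar> \<le> a / 2 * d"
      using d \<epsilon>2 by (simp add: abs_mult mult.left_commute)
    moreover have "a / 2 * d = \<epsilon> * (y - g (X \<tau>, \<tau>))" using \<open>a > 0\<close> side \<epsilon> by (auto simp: d_def)
    ultimately have reach: "\<epsilon> * y \<le> \<epsilon> * g (X \<tau> + \<epsilon> * d, \<tau>)" using \<epsilon> by (auto simp: abs_if split: if_splits)
    have "continuous_on {0..d} (\<lambda>r. \<epsilon> * g (X \<tau> + \<epsilon> * r, \<tau>))"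
    proof (intro continuous_on_mult continuous_on_const)
      have "{X \<tau> - d..X \<tau> + d} \<times> {\<tau>} \<subseteq> U" using inU by (auto simp: abs_le_iff)
      from integral_of_form_continuous_on_horizontal[OF form_g this]
      show "continuous_on {0..d} (\<lambda>r. g (X \<tau> + \<epsilon> * r, \<tau>))"
        by (rule continuous_on_compose2) (use \<epsilon> in \<open>auto intro!: continuous_intros\<close>)
    qed
    moreover have "\<epsilon> * g (X \<tau> + \<epsilon> * 0, \<tau>) \<le> \<epsilon> * y" using side by (simp add: algebra_simps)
    ultimately obtain r where r: "0 \<le> r" "r \<le> d" "\<epsilon> * g (X \<tau> + \<epsilon> * r, \<tau>) = \<epsilon> * y"
      using IVT'[of "\<lambda>r. \<epsilon> * g (X \<tau> + \<epsilon> * r, \<tau>)" 0 "\<epsilon> * y" d] reach d(1) by auto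
    then have gy: "g (X \<tau> + \<epsilon> * r, \<tau>) = y" using \<epsilon> by auto
    have "(X \<tau> + \<epsilon> * r, \<tau>) \<in> U" using inU[of "X \<tau> + \<epsilon> * r"] r \<epsilon>2 by (simp add: abs_mult)
    from k_g[OF this] have "k (y, \<tau>) - X \<tau> = \<epsilon> * r" by (simp add: gy)
    moreover have "r \<noteq> 0" using gy side by auto
    ultimately show ?thesis using r \<epsilon>2 unfolding d_def[symmetric] by (simp add: abs_mult mult.assoc[symmetric])
  qed
  ultimately show ?thesis using that by blast
qed

lemma front_limit:
  assumes \<epsilon>: "\<epsilon> = 1 \<or> \<epsilon> = - 1" and U: "(X t, t) \<in> U"
    and X: "isCont X t" and Y: "isCont (\<lambda>\<tau>. g (X \<tau>, \<tau>)) t"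
    and lim: "(w \<longlongrightarrow> x) (at (X t, t) within {(z, \<tau>). 0 < \<epsilon> * (z - X \<tau>)})" and "x \<in> W"
  shows "(w' \<longlongrightarrow> x) (at (g (X t, t), t) within {(y, \<tau>). 0 < \<epsilon> * (y - g (X \<tau>, \<tau>))})"
proof -
  let ?F = "at (g (X t, t), t) within {(y, \<tau>). 0 < \<epsilon> * (y - g (X \<tau>, \<tau>))}"
  obtain \<delta> c where "\<delta> > 0"
    and pre: "\<And>y \<tau>. \<bar>y - g (X t, t)\<bar> < \<delta> \<Longrightarrow> \<bar>\<tau> - t\<bar> < \<delta> \<Longrightarrow> 0 < \<epsilon> * (y - g (X \<tau>, \<tau>)) \<Longrightarrow>
      0 < \<epsilon> * (k (y, \<tau>) - X \<tau>) \<and> \<bar>k (y, \<tau>) - X \<tau>\<bar> \<le> c * \<bar>y - g (X \<tau>, \<tau>)\<bar>"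
    using front_preimage[OF assms] by blast
  have "eventually (\<lambda>(y, \<tau>). 0 < \<epsilon> * (y - g (X \<tau>, \<tau>)) \<longrightarrow>
      0 < \<epsilon> * (k (y, \<tau>) - X \<tau>) \<and> \<bar>k (y, \<tau>) - X \<tau>\<bar> \<le> c * \<bar>y - g (X \<tau>, \<tau>)\<bar>) (nhds (g (X t, t), t))"
    unfolding eventually_nhds_box using pre \<open>\<delta> > 0\<close> by auto
  then have ev: "eventually (\<lambda>Q. 0 < \<epsilon> * (k Q - X (snd Q)) \<and>
      \<bar>k Q - X (snd Q)\<bar> \<le> c * \<bar>fst Q - g (X (snd Q), snd Q)\<bar>) ?F"
    unfolding eventually_at_filter by eventually_elim auto
  have snd: "(snd \<longlongrightarrow> t) ?F" and fst: "(fst \<longlongrightarrow> g (X t, t)) ?F"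
    using tendsto_snd[OF tendsto_ident_at, of "(g (X t, t), t)"] tendsto_fst[OF tendsto_ident_at, of "(g (X t, t), t)"]
    by auto
  have Xs: "((\<lambda>Q. X (snd Q)) \<longlongrightarrow> X t) ?F" by (rule isCont_tendsto_compose[OF X snd])
  have "((\<lambda>Q. g (X (snd Q), snd Q)) \<longlongrightarrow> g (X t, t)) ?F" by (rule isCont_tendsto_compose[OF Y snd])
  then have "((\<lambda>Q. c * \<bar>fst Q - g (X (snd Q), snd Q)\<bar>) \<longlongrightarrow> 0) ?F"
    by (auto intro!: tendsto_eq_intros fst)
  then have "((\<lambda>Q. k Q - X (snd Q)) \<longlongrightarrow> 0) ?F"
    by (rule Lim_null_comparison[rotated]) (use ev in \<open>auto elim: eventually_mono\<close>)
  from tendsto_add[OF this Xs] have "(k \<longlongrightarrow> X t) ?F" by simp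
  then have "((\<lambda>Q. (k Q, snd Q)) \<longlongrightarrow> (X t, t)) ?F" by (intro tendsto_Pair snd)
  moreover have "eventually (\<lambda>Q. (k Q, snd Q) \<in> {(z, \<tau>). 0 < \<epsilon> * (z - X \<tau>)} \<and> (k Q, snd Q) \<noteq> (X t, t)) ?F"
    using ev by eventually_elim auto
  ultimately have "filterlim (\<lambda>Q. (k Q, snd Q)) (at (X t, t) within {(z, \<tau>). 0 < \<epsilon> * (z - X \<tau>)}) ?F"
    unfolding filterlim_at by blast
  from filterlim_compose[OF lim this] have "((\<lambda>Q. w (k Q, snd Q)) \<longlongrightarrow> x) ?F" .
  moreover have "eventually (\<lambda>Q. w (k Q, snd Q) = w' Q) ?F"
    using eventually_nhds_in_open[OF open_V g_into[OF U]] unfolding eventually_at_filter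
    by eventually_elim (auto simp: flow_k)
  ultimately show ?thesis by (rule Lim_transform_eventually)
qed

lemma front_flow:
  assumes U: "(X t, t) \<in> U" and X: "(X has_real_derivative \<sigma>) (at t)" and "wl \<in> W" "wr \<in> W"
    and left: "(w \<longlongrightarrow> wl) (at (X t, t) within {(z, \<tau>). z < X \<tau>})"
    and right: "(w \<longlongrightarrow> wr) (at (X t, t) within {(z, \<tau>). z > X \<tau>})"
  shows "((\<lambda>\<tau>. g (X \<tau>, \<tau>)) has_real_derivative B wl + \<sigma> * A wl) (at t)"
    and "(w' \<longlongrightarrow> wl) (at (g (X t, t), t) within {(y, \<tau>). y < g (X \<tau>, \<tau>)})"
    and "(w' \<longlongrightarrow> wr) (at (g (X t, t), t) within {(y, \<tau>). y > g (X \<tau>, \<tau>)})"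
proof -
  show Y: "((\<lambda>\<tau>. g (X \<tau>, \<tau>)) has_real_derivative B wl + \<sigma> * A wl) (at t)"
    by (rule front_velocity) fact+
  note cont = DERIV_isCont[OF X] DERIV_isCont[OF Y]
  show "(w' \<longlongrightarrow> wl) (at (g (X t, t), t) within {(y, \<tau>). y < g (X \<tau>, \<tau>)})"
    using front_limit[of "- 1", OF _ U cont _ \<open>wl \<in> W\<close>] left by simp
  show "(w' \<longlongrightarrow> wr) (at (g (X t, t), t) within {(y, \<tau>). y > g (X \<tau>, \<tau>)})"
    using front_limit[of 1, OF _ U cont _ \<open>wr \<in> W\<close>] right by simp
qed

end

section \<open>Characteristics in the two frames\<close>

text \<open>
  With the total energy per unit mass \<open>E\<close>, the Eulerian densities are \<open>1 / v\<close> times \<open>1, u, E\<close>, and the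
  Eulerian fluxes are \<open>u\<close> times the densities plus the Lagrangian fluxes \<open>p, u p\<close> of momentum and energy.
\<close>

definition total_energy :: "enthalpy \<Rightarrow> state \<Rightarrow> real" where
  "total_energy h = (\<lambda>(p, u, s). u\<^sup>2 / 2 + int_energy h p s)"

lemma lagrangian_alt:
  "lagrangian h = (\<lambda>w. (- state_volume h w, velocity w, total_energy h w), \<lambda>w. (velocity w, fst w, velocity w * fst w))"
  by (auto simp: lagrangian_def state_volume_def velocity_def total_energy_def)

lemma eulerian_alt:
  "eulerian h =
    (\<lambda>w. (1 / state_volume h w, velocity w / state_volume h w, total_energy h w / state_volume h w),
     \<lambda>w. (velocity w / state_volume h w, (velocity w)\<^sup>2 / state_volume h w + fst w,
       velocity w * total_energy h w / state_volume h w + velocity w * fst w))"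
  by (auto simp: eulerian_def state_volume_def velocity_def total_energy_def Let_def
    power2_eq_square power3_eq_cube algebra_simps add_divide_distrib)

lemma has_derivative_velocity: "(velocity has_derivative velocity) (at w)"
proof -
  have *: "velocity = (\<lambda>w. fst (snd w))" by (auto simp: velocity_def)
  show ?thesis unfolding * by (intro has_derivative_fst has_derivative_snd has_derivative_ident)
qed

lemma bounded_linear_frechet_derivative:
  assumes "(f has_derivative f') (at x)"
  shows "bounded_linear (frechet_derivative f (at x))"
  using has_derivative_bounded_linear[OF assms] frechet_derivative_at[OF assms] by simp

lemma has_derivative_deriv:
  fixes F :: "real \<Rightarrow> real \<Rightarrow> real"
  assumes "((\<lambda>(p, s). F p s) has_derivative F') (at (p, s))"
  shows "F' = (\<lambda>d. deriv (\<lambda>\<pi>. F \<pi> s) p * fst d + deriv (\<lambda>\<eta>. F p \<eta>) s * snd d)"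
    and "((\<lambda>\<eta>. F p \<eta>) has_real_derivative deriv (\<lambda>\<eta>. F p \<eta>) s) (at s)"
proof -
  interpret F': bounded_linear F' using assms by (rule has_derivative_bounded_linear)
  define c1 c2 where "c1 = F' (1, 0)" and "c2 = F' (0, 1)"
  have lin: "F' (a, b) = c1 * a + c2 * b" for a b
  proof -
    have "(a, b) = a *\<^sub>R (1, 0) + b *\<^sub>R (0, 1)" by simp
    then have "F' (a, b) = a *\<^sub>R F' (1, 0) + b *\<^sub>R F' (0, 1)"
      by (simp only: F'.add F'.scaleR)
    then show ?thesis by (simp only: c1_def c2_def real_scaleR_def mult.commute)
  qed
  have lines: "((\<lambda>\<pi>. (\<pi>, s)) has_derivative (\<lambda>d. (d, 0))) (at p)" "((\<lambda>\<eta>. (p, \<eta>)) has_derivative (\<lambda>d. (0, d))) (at s)"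
    by (auto intro!: derivative_eq_intros)
  from has_derivative_compose[OF lines(1) assms]
  have p: "((\<lambda>\<pi>. F \<pi> s) has_real_derivative c1) (at p)" by (simp add: has_field_derivative_def lin)
  from has_derivative_compose[OF lines(2) assms]
  have s: "((\<lambda>\<eta>. F p \<eta>) has_real_derivative c2) (at s)" by (simp add: has_field_derivative_def lin)
  show "((\<lambda>\<eta>. F p \<eta>) has_real_derivative deriv (\<lambda>\<eta>. F p \<eta>) s) (at s)"
    using s by (simp only: DERIV_imp_deriv)
  show "F' = (\<lambda>d. deriv (\<lambda>\<pi>. F \<pi> s) p * fst d + deriv (\<lambda>\<eta>. F p \<eta>) s * snd d)"
    using lin by (auto simp: DERIV_imp_deriv[OF p] DERIV_imp_deriv[OF s])
qed

locale gas =
  fixes D :: "(real \<times> real) set" and h :: enthalpy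
  assumes eos: "equation_of_state D h"
begin

lemma volume_pos: "w \<in> states D \<Longrightarrow> state_volume h w > 0"
  using eos by (auto simp: equation_of_state_def states_def state_volume_def)

text \<open>The relation \<open>dh = v dp + \<theta> ds\<close> turns into \<open>de = \<theta> ds - p dv\<close>.\<close>

lemma gas_derivatives:
  assumes "w \<in> states D"
  obtains vp vs \<theta> where "vp < 0" "\<theta> > 0"
    and "(state_volume h has_derivative (\<lambda>d. vp * fst d + vs * snd (snd d))) (at w)"
    and "(total_energy h has_derivative
      (\<lambda>d. velocity w * velocity d + \<theta> * snd (snd d) - fst w * (vp * fst d + vs * snd (snd d)))) (at w)"
proof -
  obtain p u s where w: "w = (p, u, s)" by (cases w)
  with assms have ps: "(p, s) \<in> D" by (simp add: states_def)
  define vp where "vp = deriv (\<lambda>\<pi>. spec_volume h \<pi> s) p"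
  define vs where "vs = deriv (\<lambda>\<eta>. spec_volume h p \<eta>) s"
  have proj: "((\<lambda>w. (fst w, snd (snd w))) has_derivative (\<lambda>d. (fst d, snd (snd d)))) (at w)"
    by (auto intro!: derivative_eq_intros)
  have C1: "C1_on (\<lambda>(p, s). h p s) D" "C1_on (\<lambda>(p, s). spec_volume h p s) D"
    using eos by (simp_all add: equation_of_state_def)
  note Dh = C1_on_has_derivative[OF C1(1) ps] and Dv = C1_on_has_derivative[OF C1(2) ps]
  have Dh': "((\<lambda>(p, s). h p s) has_derivative frechet_derivative (\<lambda>(p, s). h p s) (at (p, s))) (at (fst w, snd (snd w)))"
    and Dv': "((\<lambda>(p, s). spec_volume h p s) has_derivative
      frechet_derivative (\<lambda>(p, s). spec_volume h p s) (at (p, s))) (at (fst w, snd (snd w)))"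
    using Dh Dv by (simp_all add: w)
  have "((\<lambda>w. (\<lambda>(p, s). spec_volume h p s) (fst w, snd (snd w))) has_derivative
      (\<lambda>d. vp * fst d + vs * snd (snd d))) (at w)"
    using has_derivative_compose[OF proj Dv'] has_derivative_deriv(1)[OF Dv]
    by (simp add: vp_def vs_def case_prod_unfold)
  then have V: "(state_volume h has_derivative (\<lambda>d. vp * fst d + vs * snd (snd d))) (at w)"
    by (simp add: state_volume_def case_prod_unfold)
  have "((\<lambda>w. (\<lambda>(p, s). h p s) (fst w, snd (snd w))) has_derivative
      (\<lambda>d. spec_volume h p s * fst d + temperature h p s * snd (snd d))) (at w)"
    using has_derivative_compose[OF proj Dh'] has_derivative_deriv(1)[OF Dh]
    by (simp add: spec_volume_def temperature_def case_prod_unfold)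
  then have H: "((\<lambda>w. h (fst w) (snd (snd w))) has_derivative
      (\<lambda>d. state_volume h w * fst d + temperature h p s * snd (snd d))) (at w)"
    by (simp add: state_volume_def w)
  have K: "((\<lambda>w. (velocity w)\<^sup>2 / 2) has_derivative (\<lambda>d. velocity w * velocity d)) (at w)"
    by (auto intro!: derivative_eq_intros has_derivative_velocity)
  have "((\<lambda>w. (velocity w)\<^sup>2 / 2 + (h (fst w) (snd (snd w)) - fst w * state_volume h w)) has_derivative
      (\<lambda>d. velocity w * velocity d + temperature h p s * snd (snd d) - fst w * (vp * fst d + vs * snd (snd d)))) (at w)"
    using has_derivative_add[OF K has_derivative_diff[OF H has_derivative_mult[OF has_derivative_fst[OF has_derivative_ident] V]]]
    by (rule has_derivative_eq_rhs) (auto simp: algebra_simps)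
  moreover have "total_energy h = (\<lambda>w. (velocity w)\<^sup>2 / 2 + (h (fst w) (snd (snd w)) - fst w * state_volume h w))"
    by (auto simp: total_energy_def int_energy_def velocity_def state_volume_def)
  ultimately have "(total_energy h has_derivative (\<lambda>d. velocity w * velocity d + temperature h p s * snd (snd d)
      - fst w * (vp * fst d + vs * snd (snd d)))) (at w)" by simp
  moreover have "vp < 0" "temperature h p s > 0"
    using eos ps by (auto simp: equation_of_state_def vp_def)
  ultimately show ?thesis using that V by blast
qed

definition dV where "dV w = frechet_derivative (state_volume h) (at w)"
definition dE where "dE w = frechet_derivative (total_energy h) (at w)"

lemma has_derivative_volume: "w \<in> states D \<Longrightarrow> (state_volume h has_derivative dV w) (at w)"
  and has_derivative_energy: "w \<in> states D \<Longrightarrow> (total_energy h has_derivative dE w) (at w)"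
proof -
  assume "w \<in> states D"
  then have "state_volume h differentiable (at w)" "total_energy h differentiable (at w)"
    using gas_derivatives unfolding differentiable_def by blast+
  then show "(state_volume h has_derivative dV w) (at w)" "(total_energy h has_derivative dE w) (at w)"
    by (simp_all add: dV_def dE_def frechet_derivative_works)
qed

lemma has_derivative_lagrangian:
  assumes "w \<in> states D"
  shows "(fst (lagrangian h) has_derivative (\<lambda>d. (- dV w d, velocity d, dE w d))) (at w)"
    and "(snd (lagrangian h) has_derivative
      (\<lambda>d. (velocity d, fst d, velocity w * fst d + velocity d * fst w))) (at w)"
  unfolding lagrangian_alt fst_conv snd_conv
  by (auto intro!: derivative_eq_intros has_derivative_volume has_derivative_energy has_derivative_velocity assms)

lemma has_derivative_eulerian:
  assumes "w \<in> states D"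
  shows "(fst (eulerian h) has_derivative (\<lambda>d.
      (- dV w d / (state_volume h w)\<^sup>2,
       velocity d / state_volume h w - velocity w * dV w d / (state_volume h w)\<^sup>2,
       dE w d / state_volume h w - total_energy h w * dV w d / (state_volume h w)\<^sup>2))) (at w)"
    and "(snd (eulerian h) has_derivative (\<lambda>d.
      (velocity d / state_volume h w - velocity w * dV w d / (state_volume h w)\<^sup>2,
       2 * velocity w * velocity d / state_volume h w - (velocity w)\<^sup>2 * dV w d / (state_volume h w)\<^sup>2 + fst d,
       (velocity d * total_energy h w + velocity w * dE w d) / state_volume h w
         - velocity w * total_energy h w * dV w d / (state_volume h w)\<^sup>2
         + velocity d * fst w + velocity w * fst d))) (at w)"
proof -
  have V: "state_volume h w \<noteq> 0" using volume_pos[OF assms] by simp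
  note D = has_derivative_volume[OF assms] has_derivative_energy[OF assms] has_derivative_velocity
  show "(fst (eulerian h) has_derivative (\<lambda>d.
      (- dV w d / (state_volume h w)\<^sup>2,
       velocity d / state_volume h w - velocity w * dV w d / (state_volume h w)\<^sup>2,
       dE w d / state_volume h w - total_energy h w * dV w d / (state_volume h w)\<^sup>2))) (at w)"
    unfolding eulerian_alt fst_conv
    by (rule has_derivative_Pair; (rule has_derivative_Pair)?;
        (rule derivative_eq_intros D V refl)+; auto simp: V field_simps power2_eq_square)+
  show "(snd (eulerian h) has_derivative (\<lambda>d.
      (velocity d / state_volume h w - velocity w * dV w d / (state_volume h w)\<^sup>2,
       2 * velocity w * velocity d / state_volume h w - (velocity w)\<^sup>2 * dV w d / (state_volume h w)\<^sup>2 + fst d,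
       (velocity d * total_energy h w + velocity w * dE w d) / state_volume h w
         - velocity w * total_energy h w * dV w d / (state_volume h w)\<^sup>2
         + velocity d * fst w + velocity w * fst d))) (at w)"
    unfolding eulerian_alt snd_conv
    by (rule has_derivative_Pair; (rule has_derivative_Pair)?;
        (rule derivative_eq_intros D V refl)+; auto simp: V field_simps power2_eq_square)+
qed

text \<open>
  The Eulerian mass balance is \<open>\<rho>\<^sup>2\<close> times the Lagrangian one, and every other Eulerian balance is \<open>\<rho>\<close>
  times its Lagrangian counterpart plus a multiple of the mass balance. For \<open>a = w\<^sub>t\<close> and \<open>b = w\<^sub>x\<close> the
  arguments on the Eulerian side are \<open>w\<^sub>t\<close> at fixed \<open>y\<close> and \<open>w\<^sub>y\<close>, so that the two systems have the same
  solutions; for \<open>a = - \<lambda> r\<close> and \<open>b = r\<close> they have the same eigenvectors.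
\<close>

lemma balance_iff:
  assumes w: "w \<in> states D"
  defines "V \<equiv> state_volume h w" and "u \<equiv> velocity w"
  shows "frechet_derivative (fst (lagrangian h)) (at w) a + frechet_derivative (snd (lagrangian h)) (at w) b = 0 \<longleftrightarrow>
    frechet_derivative (fst (eulerian h)) (at w) (a - (u / V) *\<^sub>R b) +
    frechet_derivative (snd (eulerian h)) (at w) ((1 / V) *\<^sub>R b) = 0"
proof -
  have V: "V > 0" using volume_pos[OF w] by (simp add: V_def)
  interpret dV: bounded_linear "dV w" using has_derivative_volume[OF w] by (rule has_derivative_bounded_linear)
  interpret dE: bounded_linear "dE w" using has_derivative_energy[OF w] by (rule has_derivative_bounded_linear)
  interpret du: bounded_linear velocity using has_derivative_velocity by (rule has_derivative_bounded_linear)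
  define E where "E = total_energy h w"
  define mass where "mass = - dV w a + velocity b"
  define momentum where "momentum = velocity a + fst b"
  define energy where "energy = dE w a + (u * fst b + velocity b * fst w)"
  have L: "frechet_derivative (fst (lagrangian h)) (at w) a + frechet_derivative (snd (lagrangian h)) (at w) b =
      (mass, momentum, energy)"
    unfolding has_derivative_lagrangian[OF w, THEN frechet_derivative_at, symmetric]
    by (simp add: mass_def momentum_def energy_def u_def)
  have "frechet_derivative (fst (eulerian h)) (at w) (a - (u / V) *\<^sub>R b) +
      frechet_derivative (snd (eulerian h)) (at w) ((1 / V) *\<^sub>R b) =
      (mass / V\<^sup>2, momentum / V + u * mass / V\<^sup>2, energy / V + E * mass / V\<^sup>2)"
    unfolding has_derivative_eulerian[OF w, THEN frechet_derivative_at, symmetric] V_def[symmetric] u_def[symmetric]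
      E_def[symmetric] dV.diff dV.scaleR dE.diff dE.scaleR du.diff du.scaleR
    using V by (simp add: mass_def momentum_def energy_def field_simps power2_eq_square)
  then show ?thesis using V unfolding L by (auto simp: zero_prod_def)
qed

corollary gen_eigenpair_iff:
  assumes w: "w \<in> states D"
  shows "gen_eigenpair (lagrangian h) w \<mu> r \<longleftrightarrow>
    gen_eigenpair (eulerian h) w (velocity w + state_volume h w * \<mu>) r"
proof -
  define V u where "V = state_volume h w" and "u = velocity w"
  have V: "V > 0" using volume_pos[OF w] by (simp add: V_def)
  interpret L0: bounded_linear "frechet_derivative (fst (lagrangian h)) (at w)"
    by (rule bounded_linear_frechet_derivative has_derivative_lagrangian w)+
  interpret E0: bounded_linear "frechet_derivative (fst (eulerian h)) (at w)"
    by (rule bounded_linear_frechet_derivative has_derivative_eulerian w)+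
  interpret E1: bounded_linear "frechet_derivative (snd (eulerian h)) (at w)"
    by (rule bounded_linear_frechet_derivative has_derivative_eulerian w)+
  have "- \<mu> - u / V = 1 / V * (- (u + V * \<mu>))" using V by (simp add: field_simps)
  then have split: "(- \<mu>) *\<^sub>R r - (u / V) *\<^sub>R r = (1 / V) *\<^sub>R (- (u + V * \<mu>)) *\<^sub>R r"
    by (simp only: scaleR_left_diff_distrib[symmetric] scaleR_scaleR)
  have "frechet_derivative (fst (eulerian h)) (at w) ((- \<mu>) *\<^sub>R r - (u / V) *\<^sub>R r) +
      frechet_derivative (snd (eulerian h)) (at w) ((1 / V) *\<^sub>R r) =
      (1 / V) *\<^sub>R (frechet_derivative (snd (eulerian h)) (at w) r
        - (u + V * \<mu>) *\<^sub>R frechet_derivative (fst (eulerian h)) (at w) r)"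
    by (simp only: split E0.scaleR E1.scaleR scaleR_add_right[symmetric])
      (simp only: scaleR_minus_left diff_conv_add_uminus add.commute)
  moreover have "frechet_derivative (fst (lagrangian h)) (at w) ((- \<mu>) *\<^sub>R r) +
      frechet_derivative (snd (lagrangian h)) (at w) r =
      frechet_derivative (snd (lagrangian h)) (at w) r - \<mu> *\<^sub>R frechet_derivative (fst (lagrangian h)) (at w) r"
    by (simp only: L0.scaleR) simp
  ultimately show ?thesis
    using balance_iff[OF w, of "(- \<mu>) *\<^sub>R r" r] V by (simp add: gen_eigenpair_def V_def u_def)
qed

text \<open>
  The entropy direction is the eigenvector of zero. Along the others the entropy is constant, and
  eliminating the velocity from \<open>du = - \<lambda> dv\<close>, \<open>dp = \<lambda> du\<close> leaves \<open>\<lambda>\<^sup>2 (- \<partial>v / \<partial>p) = 1\<close>.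
\<close>

lemma lagrangian_spectrum:
  assumes w: "w \<in> states D"
  obtains c where "c > 0" "gen_spectrum (lagrangian h) w = {- c, 0, c}"
proof -
  obtain vp vs \<theta> where vp: "vp < 0" and \<theta>: "\<theta> > 0"
    and V: "(state_volume h has_derivative (\<lambda>d. vp * fst d + vs * snd (snd d))) (at w)"
    and E: "(total_energy h has_derivative
      (\<lambda>d. velocity w * velocity d + \<theta> * snd (snd d) - fst w * (vp * fst d + vs * snd (snd d)))) (at w)"
    using gas_derivatives[OF w] by blast
  have dV: "dV w = (\<lambda>d. vp * fst d + vs * snd (snd d))"
    using frechet_derivative_at[OF V] by (simp add: dV_def)
  have dE: "dE w = (\<lambda>d. velocity w * velocity d + \<theta> * snd (snd d) - fst w * (vp * fst d + vs * snd (snd d)))"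
    using frechet_derivative_at[OF E] by (simp add: dE_def)
  obtain p u s where ws: "w = (p, u, s)" by (cases w)
  have pair: "gen_eigenpair (lagrangian h) w \<mu> (a, b, c) \<longleftrightarrow> (a, b, c) \<noteq> (0, 0, 0) \<and>
      b = - \<mu> * (vp * a + vs * c) \<and> a = \<mu> * b \<and> \<mu> * c = 0" for \<mu> a b c
  proof -
    have "gen_eigenpair (lagrangian h) w \<mu> (a, b, c) \<longleftrightarrow> (a, b, c) \<noteq> (0, 0, 0) \<and>
      b = - \<mu> * (vp * a + vs * c) \<and> a = \<mu> * b \<and>
      u * a + b * p = \<mu> * (u * b + \<theta> * c - p * (vp * a + vs * c))"
      unfolding gen_eigenpair_def has_derivative_lagrangian[OF w, THEN frechet_derivative_at, symmetric] dV dE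
      by (simp add: ws velocity_def zero_prod_def algebra_simps)
    moreover have "u * a + b * p = \<mu> * (u * b + \<theta> * c - p * (vp * a + vs * c)) \<longleftrightarrow> \<mu> * c = 0"
      if "b = - \<mu> * (vp * a + vs * c)" "a = \<mu> * b"
    proof -
      have "\<mu> * (u * b + \<theta> * c - p * (vp * a + vs * c)) = u * (\<mu> * b) + \<theta> * (\<mu> * c) + p * (- \<mu> * (vp * a + vs * c))"
        by (simp add: algebra_simps)
      also have "\<dots> = u * a + \<theta> * (\<mu> * c) + p * b" by (simp only: that[symmetric])
      finally show ?thesis using \<theta> by auto
    qed
    ultimately show ?thesis by blast
  qed
  \<comment> \<open>the Lagrangian sound speed\<close>
  define c where "c = 1 / sqrt (- vp)"
  have c: "c > 0" "c * c * (- vp) = 1" using vp by (auto simp: c_def field_simps)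
  have "\<mu> \<in> gen_spectrum (lagrangian h) w \<longleftrightarrow> \<mu> \<in> {- c, 0, c}" for \<mu>
  proof
    assume "\<mu> \<in> gen_spectrum (lagrangian h) w"
    then obtain a b d where e: "gen_eigenpair (lagrangian h) w \<mu> (a, b, d)"
      by (auto simp: gen_spectrum_def) 
    show "\<mu> \<in> {- c, 0, c}"
    proof (cases "\<mu> = 0")
      case False
      have e': "(a, b, d) \<noteq> (0, 0, 0)" "b = - \<mu> * (vp * a + vs * d)" "a = \<mu> * b" "\<mu> * d = 0"
        using e unfolding pair by blast+
      have "d = 0" using e'(4) False by simp
      have b: "b = - \<mu> * (vp * a)" using e'(2) \<open>d = 0\<close> by simp
      have "a \<noteq> 0"
      proof
        assume "a = 0"
        then have "b = 0" using b by simp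
        then show False using e'(1) \<open>a = 0\<close> \<open>d = 0\<close> by simp
      qed
      have "\<mu> * \<mu> * (- vp) * a = \<mu> * (- \<mu> * (vp * a))" by simp
      also have "\<dots> = a" by (simp only: b[symmetric] e'(3)[symmetric])
      finally have "\<mu> * \<mu> * (- vp) * a = a" .
      then have "(\<mu> * \<mu> * (- vp) - 1) * a = 0" by (simp add: algebra_simps)
      then have "\<mu> * \<mu> * (- vp) = 1" using \<open>a \<noteq> 0\<close> by simp
      with c(2) have "(\<mu> * \<mu> - c * c) * (- vp) = 0" by (simp add: algebra_simps)
      then have "\<mu> * \<mu> = c * c" using vp by simp
      then show ?thesis by (auto simp: square_eq_iff)
    qed simp
  next
    assume "\<mu> \<in> {- c, 0, c}"
    then consider "\<mu> = 0" | "\<mu> * \<mu> = c * c" by auto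
    then show "\<mu> \<in> gen_spectrum (lagrangian h) w"
    proof cases
      case 1
      then have "gen_eigenpair (lagrangian h) w \<mu> (0, 0, 1)" by (simp add: pair)
      then show ?thesis by (auto simp: gen_spectrum_def)
    next
      case 2
      have "\<mu> * (- \<mu> * vp) = \<mu> * \<mu> * (- vp)" by simp
      also have "\<dots> = 1" using c(2) by (simp only: 2)
      finally have "gen_eigenpair (lagrangian h) w \<mu> (1, - \<mu> * vp, 0)" by (simp add: pair)
      then show ?thesis by (auto simp: gen_spectrum_def)
    qed
  qed
  then show ?thesis using that c(1) by blast
qed

lemma wavespeeds:
  assumes w: "w \<in> states D"
  shows "strictly_hyperbolic_at (lagrangian h) w" "strictly_hyperbolic_at (eulerian h) w"
    and "wavespeed (eulerian h) i w = velocity w + state_volume h w * wavespeed (lagrangian h) i w"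
proof -
  obtain c where c: "c > 0" and L: "gen_spectrum (lagrangian h) w = {- c, 0, c}"
    using lagrangian_spectrum[OF w] .
  define V u where "V = state_volume h w" and "u = velocity w"
  have V: "V > 0" using volume_pos[OF w] by (simp add: V_def)
  have "gen_spectrum (eulerian h) w = (\<lambda>\<mu>. u + V * \<mu>) ` gen_spectrum (lagrangian h) w"
  proof -
    have iff: "\<nu> \<in> gen_spectrum (lagrangian h) w \<longleftrightarrow> u + V * \<nu> \<in> gen_spectrum (eulerian h) w" for \<nu>
      by (simp add: gen_spectrum_def gen_eigenpair_iff[OF w] V_def u_def)
    have "\<mu> \<in> (\<lambda>\<mu>. u + V * \<mu>) ` gen_spectrum (lagrangian h) w" if "\<mu> \<in> gen_spectrum (eulerian h) w" for \<mu>
      using that iff[of "(\<mu> - u) / V"] V by (intro image_eqI[of _ _ "(\<mu> - u) / V"]) auto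
    then show ?thesis using iff by blast
  qed
  then have E: "gen_spectrum (eulerian h) w = {u - V * c, u, u + V * c}" unfolding L by auto
  have "V * c > 0" using V c by simp
  then have sE: "sorted_list_of_set (gen_spectrum (eulerian h) w) = [u - V * c, u, u + V * c]"
    and cE: "card (gen_spectrum (eulerian h) w) = 3"
    unfolding E using V c by simp_all
  have sL: "sorted_list_of_set (gen_spectrum (lagrangian h) w) = [- c, 0, c]"
    and cL: "card (gen_spectrum (lagrangian h) w) = 3"
    unfolding L using c by simp_all
  show "strictly_hyperbolic_at (lagrangian h) w" "strictly_hyperbolic_at (eulerian h) w"
    using cL cE by (simp_all add: strictly_hyperbolic_at_def)
  show "wavespeed (eulerian h) i w = velocity w + state_volume h w * wavespeed (lagrangian h) i w"
    by (cases i) (simp_all add: wavespeed_def sE sL V_def u_def)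
qed

lemma simple_wave_curve_iff:
  "simple_wave_curve (lagrangian h) (states D) i J \<gamma> \<longleftrightarrow> simple_wave_curve (eulerian h) (states D) i J \<gamma>"
proof -
  have "gen_eigenpair (lagrangian h) w (wavespeed (lagrangian h) i w) r \<longleftrightarrow>
      gen_eigenpair (eulerian h) w (wavespeed (eulerian h) i w) r" if "w \<in> states D" for w r
    using gen_eigenpair_iff[OF that] wavespeeds(3)[OF that] by simp
  then show ?thesis unfolding simple_wave_curve_def by (simp cong: conj_cong)
qed

end

section \<open>Shocks and contacts in the two frames\<close>

context gas
begin

text \<open>
  A front of Lagrangian speed \<open>\<sigma>\<close> moves past the particles on either side, so that its Eulerian
  speed can be computed from either side; the mass balance across the jump says that the two
  values agree, and then they agree with their mean.
\<close>

lemma average_speed: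
  assumes "velocity wl + state_volume h wl * \<sigma> = velocity wr + state_volume h wr * \<sigma>"
  shows "average velocity wl wr + average (state_volume h) wl wr * \<sigma> = velocity wl + state_volume h wl * \<sigma>"
    and "average velocity wl wr + average (state_volume h) wl wr * \<sigma> = velocity wr + state_volume h wr * \<sigma>"
proof -
  have mean: "average velocity wl wr + average (state_volume h) wl wr * \<sigma> =
      ((velocity wl + state_volume h wl * \<sigma>) + (velocity wr + state_volume h wr * \<sigma>)) / 2"
    by (simp add: average_def field_simps)
  have "(a + b) / 2 = a" "(a + b) / 2 = b" if "a = b" for a b :: real
    using that by simp_all
  from this[OF assms]
  show "average velocity wl wr + average (state_volume h) wl wr * \<sigma> = velocity wl + state_volume h wl * \<sigma>"
    "average velocity wl wr + average (state_volume h) wl wr * \<sigma> = velocity wr + state_volume h wr * \<sigma>"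
    unfolding mean .
qed

lemma lagrangian_jump:
  "jump_condition (lagrangian h) wl wr \<sigma> \<longleftrightarrow>
    velocity wl + state_volume h wl * \<sigma> = velocity wr + state_volume h wr * \<sigma> \<and>
    fst wr - fst wl = \<sigma> * (velocity wr - velocity wl) \<and>
    velocity wr * fst wr - velocity wl * fst wl = \<sigma> * (total_energy h wr - total_energy h wl)"
  by (auto simp: jump_condition_def lagrangian_alt algebra_simps)

lemma average_volume_pos:
  "wl \<in> states D \<Longrightarrow> wr \<in> states D \<Longrightarrow> average (state_volume h) wl wr > 0"
  using volume_pos[of wl] volume_pos[of wr] by (simp add: average_def)

text \<open>
  In either system the mass balance alone makes the speeds computed on the two sides agree. The
  remaining balances then correspond one by one.
\<close>

lemma jump_condition_iff:
  assumes wl: "wl \<in> states D" and wr: "wr \<in> states D"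
  shows "jump_condition (lagrangian h) wl wr \<sigma> \<longleftrightarrow>
    jump_condition (eulerian h) wl wr (average velocity wl wr + average (state_volume h) wl wr * \<sigma>)"
proof -
  define s where "s = average velocity wl wr + average (state_volume h) wl wr * \<sigma>"
  define vl vr ul ur pl pr El Er where "vl = state_volume h wl" and "vr = state_volume h wr"
    and "ul = velocity wl" and "ur = velocity wr" and "pl = fst wl" and "pr = fst wr"
    and "El = total_energy h wl" and "Er = total_energy h wr"
  note defs = vl_def vr_def ul_def ur_def pl_def pr_def El_def Er_def
  have v: "vl > 0" "vr > 0" using volume_pos wl wr by (auto simp: defs)
  have E: "jump_condition (eulerian h) wl wr s \<longleftrightarrow>
      ur / vr - ul / vl = s * (1 / vr - 1 / vl) \<and>
      (ur\<^sup>2 / vr + pr) - (ul\<^sup>2 / vl + pl) = s * (ur / vr - ul / vl) \<and>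
      (ur * Er / vr + ur * pr) - (ul * El / vl + ul * pl) = s * (Er / vr - El / vl)"
    by (simp add: jump_condition_def eulerian_alt defs)
  \<comment> \<open>Once the speeds computed on the two sides agree, \<open>s\<close> times the density of a quantity minus its
    convective flux is \<open>\<sigma>\<close> times the quantity per unit mass.\<close>
  have balance: "(ur * gr / vr + Fr) - (ul * gl / vl + Fl) = s * (gr / vr - gl / vl) \<longleftrightarrow> Fr - Fl = \<sigma> * (gr - gl)"
    if "s = ul + vl * \<sigma>" "s = ur + vr * \<sigma>" for gl gr Fl Fr
  proof -
    have u: "ul = s - vl * \<sigma>" "ur = s - vr * \<sigma>" using that by simp_all
    have "(s - v * \<sigma>) * g / v = s * (g / v) - \<sigma> * g" if "v > 0" for v g
      using that by (simp add: field_simps)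
    from this[OF v(1)] this[OF v(2)]
    have "ul * gl / vl = s * (gl / vl) - \<sigma> * gl" "ur * gr / vr = s * (gr / vr) - \<sigma> * gr"
      by (simp_all only: u)
    then show ?thesis by (simp only:) (auto simp: algebra_simps)
  qed
  have same: "jump_condition (eulerian h) wl wr s \<longleftrightarrow> jump_condition (lagrangian h) wl wr \<sigma>"
    if "s = ul + vl * \<sigma>" "s = ur + vr * \<sigma>"
    using balance[OF that, of 1 0 1 0] balance[OF that, of ur pr ul pl] balance[OF that, of Er "ur * pr" El "ul * pl"]
      that unfolding E lagrangian_jump defs[symmetric] by (simp add: power2_eq_square)
  have "s = ul + vl * \<sigma> \<and> s = ur + vr * \<sigma>" if "jump_condition (lagrangian h) wl wr \<sigma>"
    using that average_speed[of wl \<sigma> wr] unfolding lagrangian_jump s_def defs by simp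
  moreover have "s = ul + vl * \<sigma> \<and> s = ur + vr * \<sigma>" if "jump_condition (eulerian h) wl wr s"
  proof -
    \<comment> \<open>the mass flux through the front, which the Eulerian mass balance makes continuous\<close>
    define m where "m = (s - ul) / vl"
    have "ur / vr - ul / vl = s * (1 / vr - 1 / vl)" using that unfolding E by blast
    then have m: "m = (s - ur) / vr" by (simp add: m_def diff_divide_distrib right_diff_distrib)
    have sides: "s = ul + vl * m" "s = ur + vr * m"
      using v by (simp add: m_def, simp add: m)
    then have "s = average velocity wl wr + average (state_volume h) wl wr * m"
      using average_speed(1)[of wl m wr] unfolding defs by simp
    then have "average (state_volume h) wl wr * m = average (state_volume h) wl wr * \<sigma>" by (simp only: s_def add_left_cancel)
    then have "m = \<sigma>" using average_volume_pos[OF wl wr] by simp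
    then show ?thesis using sides by simp
  qed
  ultimately show ?thesis using same unfolding s_def by blast
qed

text \<open>On the isobaric sections, which are intervals, \<open>\<partial>h / \<partial>s = \<theta> > 0\<close>.\<close>

lemma entropy_determined:
  assumes "(p, s1) \<in> D" "(p, s2) \<in> D" "h p s1 = h p s2"
  shows "s1 = s2"
proof -
  have less: "h p a < h p b" if "(p, a) \<in> D" "(p, b) \<in> D" "a < b" for a b
  proof (rule DERIV_pos_imp_increasing[OF \<open>a < b\<close>])
    fix x assume "a \<le> x" "x \<le> b"
    have "is_interval {s. (p, s) \<in> D}" using eos by (simp add: equation_of_state_def)
    from mem_is_interval_1_I[OF this _ _ \<open>a \<le> x\<close> \<open>x \<le> b\<close>] that have D: "(p, x) \<in> D" by simp
    have "C1_on (\<lambda>(p, s). h p s) D" using eos by (simp add: equation_of_state_def)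
    from has_derivative_deriv(2)[OF C1_on_has_derivative[OF this D]]
    have "(h p has_real_derivative temperature h p x) (at x)" by (simp add: temperature_def)
    moreover have "temperature h p x > 0" using eos D by (auto simp: equation_of_state_def)
    ultimately show "\<exists>y. (h p has_real_derivative y) (at x) \<and> 0 < y" by blast
  qed
  then show ?thesis using assms by (metis less_irrefl linorder_less_linear)
qed

text \<open>
  Two speeds for the same pair of states would make all conserved quantities, hence all fluxes and
  the enthalpy, equal on both sides; as the enthalpy determines the entropy at given pressure, the
  states would coincide.
\<close>

lemma lagrangian_speed_unique:
  assumes wl: "wl \<in> states D" and wr: "wr \<in> states D" and "wl \<noteq> wr"
    and 1: "jump_condition (lagrangian h) wl wr \<sigma>" and 2: "jump_condition (lagrangian h) wl wr \<sigma>'"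
  shows "\<sigma> = \<sigma>'"
proof (rule ccontr)
  assume "\<sigma> \<noteq> \<sigma>'"
  have "(\<sigma> - \<sigma>') *\<^sub>R (fst (lagrangian h) wr - fst (lagrangian h) wl) = 0"
    using trans[OF 1[unfolded jump_condition_def, symmetric] 2[unfolded jump_condition_def]]
    by (simp only: scaleR_left_diff_distrib diff_self)
  with \<open>\<sigma> \<noteq> \<sigma>'\<close> have q: "fst (lagrangian h) wr = fst (lagrangian h) wl" by simp
  with 1 have f: "snd (lagrangian h) wr = snd (lagrangian h) wl" by (simp add: jump_condition_def)
  obtain pl ul sl pr ur sr where ws: "wl = (pl, ul, sl)" "wr = (pr, ur, sr)" by (cases wl, cases wr)
  have "pr = pl" "ur = ul" "h pr sr = h pl sl"
    using q f by (auto simp: ws lagrangian_def int_energy_def)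
  then have "sr = sl" using entropy_determined[of pl sr sl] wl wr by (simp add: ws states_def)
  with \<open>pr = pl\<close> \<open>ur = ul\<close> \<open>wl \<noteq> wr\<close> show False by (simp add: ws)
qed

text \<open>All comparisons of a shock speed with characteristic speeds carry over because \<open>v > 0\<close>.\<close>

lemma speed_order:
  assumes w: "w \<in> states D" and s: "s = velocity w + state_volume h w * \<sigma>"
  shows "s < wavespeed (eulerian h) i w \<longleftrightarrow> \<sigma> < wavespeed (lagrangian h) i w"
    and "wavespeed (eulerian h) i w < s \<longleftrightarrow> wavespeed (lagrangian h) i w < \<sigma>"
    and "s = wavespeed (eulerian h) i w \<longleftrightarrow> \<sigma> = wavespeed (lagrangian h) i w"
  using volume_pos[OF w] by (simp_all add: wavespeeds(3)[OF w] s)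

lemma shock_or_contact_iff:
  "shock_or_contact (lagrangian h) (states D) i wl wr \<sigma> \<longleftrightarrow>
    shock_or_contact (eulerian h) (states D) i wl wr (average velocity wl wr + average (state_volume h) wl wr * \<sigma>)"
  (is "?L \<longleftrightarrow> ?E")
  and lax_shock_iff:
  "lax_shock (lagrangian h) (states D) i wl wr \<sigma> \<longleftrightarrow>
    lax_shock (eulerian h) (states D) i wl wr (average velocity wl wr + average (state_volume h) wl wr * \<sigma>)"
  (is "?LL \<longleftrightarrow> ?EL")
proof -
  let ?s = "average velocity wl wr + average (state_volume h) wl wr * \<sigma>"
  let ?same_order = "\<lambda>w. \<forall>j.
    (wavespeed (eulerian h) j w < ?s \<longleftrightarrow> wavespeed (lagrangian h) j w < \<sigma>) \<and>
    (?s < wavespeed (eulerian h) j w \<longleftrightarrow> \<sigma> < wavespeed (lagrangian h) j w)"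
  have main: "(?L \<longleftrightarrow> ?E) \<and> ?same_order wl \<and> ?same_order wr"
    if wl: "wl \<in> states D" and wr: "wr \<in> states D" and jump: "jump_condition (lagrangian h) wl wr \<sigma>"
  proof -
    have "velocity wl + state_volume h wl * \<sigma> = velocity wr + state_volume h wr * \<sigma>"
      using jump unfolding lagrangian_jump by blast
    note avg = average_speed[OF this]
    show ?thesis
      using jump jump_condition_iff[OF wl wr, of \<sigma>] wl wr
      by (auto simp: shock_or_contact_def speed_order[OF wl avg(1)] speed_order[OF wr avg(2)] split: family.split)
  qed
  show iff: "?L \<longleftrightarrow> ?E"
    using main jump_condition_iff[of wl wr \<sigma>] unfolding shock_or_contact_def by blast
  have "?L \<Longrightarrow> ?same_order wl \<and> ?same_order wr"
    using main unfolding shock_or_contact_def by blast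
  then show "?LL \<longleftrightarrow> ?EL" using iff unfolding lax_shock_def by blast
qed

text \<open>
  The compatibility conditions of \<open>kinked_map\<close>, for the form \<open>v dx + u dt\<close> and for its inverse.
\<close>

lemma speed_from_sides:
  assumes "shock_or_contact (lagrangian h) (states D) i wl wr \<sigma>"
  defines "s \<equiv> average velocity wl wr + average (state_volume h) wl wr * \<sigma>"
  shows "wl \<in> states D" "wr \<in> states D"
    and "s = velocity wl + \<sigma> * state_volume h wl" "s = velocity wr + \<sigma> * state_volume h wr"
    and "\<sigma> = - velocity wl / state_volume h wl + s * (1 / state_volume h wl)"
    and "\<sigma> = - velocity wr / state_volume h wr + s * (1 / state_volume h wr)"
proof -
  have jump: "jump_condition (lagrangian h) wl wr \<sigma>" and w: "wl \<in> states D" "wr \<in> states D"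
    using assms(1) by (auto simp: shock_or_contact_def)
  from jump have "velocity wl + state_volume h wl * \<sigma> = velocity wr + state_volume h wr * \<sigma>"
    unfolding lagrangian_jump by blast
  from average_speed[OF this]
  show s: "s = velocity wl + \<sigma> * state_volume h wl" "s = velocity wr + \<sigma> * state_volume h wr"
    unfolding s_def by (simp_all add: mult.commute)
  show "\<sigma> = - velocity wl / state_volume h wl + s * (1 / state_volume h wl)"
    using volume_pos[OF w(1)] unfolding s(1) by (simp add: field_simps)
  show "\<sigma> = - velocity wr / state_volume h wr + s * (1 / state_volume h wr)"
    using volume_pos[OF w(2)] unfolding s(2) by (simp add: field_simps)
qed (use assms(1) in \<open>auto simp: shock_or_contact_def\<close>)

lemma eulerian_speed_form:
  assumes "wl \<in> states D" "wr \<in> states D"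
  obtains \<sigma> where "s = average velocity wl wr + average (state_volume h) wl wr * \<sigma>"
proof
  show "s = average velocity wl wr + average (state_volume h) wl wr *
      ((s - average velocity wl wr) / average (state_volume h) wl wr)"
    using average_volume_pos[OF assms] by simp
qed

lemma shock_speeds:
  assumes L: "shock_or_contact (lagrangian h) (states D) i wl wr \<sigma>L"
    and E: "shock_or_contact (eulerian h) (states D) i wl wr \<sigma>E"
  shows "\<sigma>E = average velocity wl wr + average (state_volume h) wl wr * \<sigma>L"
proof -
  have w: "wl \<in> states D" "wr \<in> states D" "wl \<noteq> wr" using L by (auto simp: shock_or_contact_def)
  obtain \<sigma> where \<sigma>: "\<sigma>E = average velocity wl wr + average (state_volume h) wl wr * \<sigma>"
    using eulerian_speed_form[OF w(1,2)] .
  with E have "shock_or_contact (lagrangian h) (states D) i wl wr \<sigma>" using shock_or_contact_iff by simp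
  with L have "\<sigma> = \<sigma>L" using lagrangian_speed_unique[OF w] by (simp add: shock_or_contact_def)
  with \<sigma> show ?thesis by simp
qed

lemma same_shocks:
  "(\<exists>\<sigma>. shock_or_contact (lagrangian h) (states D) i wl wr \<sigma>) \<longleftrightarrow>
   (\<exists>\<sigma>. shock_or_contact (eulerian h) (states D) i wl wr \<sigma>)"
  "(\<exists>\<sigma>. lax_shock (lagrangian h) (states D) i wl wr \<sigma>) \<longleftrightarrow>
   (\<exists>\<sigma>. lax_shock (eulerian h) (states D) i wl wr \<sigma>)"
proof -
  have form: "\<exists>\<sigma>. s = average velocity wl wr + average (state_volume h) wl wr * \<sigma>"
    if "shock_or_contact (eulerian h) (states D) i wl wr s" for s
    using that eulerian_speed_form[of wl wr s] unfolding shock_or_contact_def by blast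
  show "(\<exists>\<sigma>. shock_or_contact (lagrangian h) (states D) i wl wr \<sigma>) \<longleftrightarrow>
   (\<exists>\<sigma>. shock_or_contact (eulerian h) (states D) i wl wr \<sigma>)"
    using form shock_or_contact_iff by blast
  show "(\<exists>\<sigma>. lax_shock (lagrangian h) (states D) i wl wr \<sigma>) \<longleftrightarrow>
   (\<exists>\<sigma>. lax_shock (eulerian h) (states D) i wl wr \<sigma>)"
  proof
    assume "\<exists>\<sigma>. lax_shock (eulerian h) (states D) i wl wr \<sigma>"
    then obtain s where s: "lax_shock (eulerian h) (states D) i wl wr s" by blast
    with form obtain \<sigma> where "s = average velocity wl wr + average (state_volume h) wl wr * \<sigma>"
      unfolding lax_shock_def by blast
    with s show "\<exists>\<sigma>. lax_shock (lagrangian h) (states D) i wl wr \<sigma>" using lax_shock_iff by blast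
  qed (use lax_shock_iff in blast)
qed

end

section \<open>Flows in corresponding frames\<close>

text \<open>
  For continuously differentiable flows with values in a set where the densities and fluxes are
  differentiable, the conservation laws are equivalent to their quasilinear form.
\<close>

lemma classical_solution_iff:
  assumes "\<And>x. x \<in> W \<Longrightarrow> (fst S has_derivative Dq x) (at x)" "\<And>x. x \<in> W \<Longrightarrow> (snd S has_derivative Df x) (at x)"
  shows "classical_solution S W U w \<longleftrightarrow> w ` U \<subseteq> W \<and> C1_on w U \<and>
    (\<forall>(z, t)\<in>U. Dq (w (z, t)) (frechet_derivative w (at (z, t)) (0, 1)) +
                Df (w (z, t)) (frechet_derivative w (at (z, t)) (1, 0)) = 0)"
proof -
  have "(\<exists>a b. ((\<lambda>\<tau>. fst S (w (z, \<tau>))) has_vector_derivative a) (at t) \<and>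
        ((\<lambda>\<zeta>. snd S (w (\<zeta>, t))) has_vector_derivative b) (at z) \<and> a + b = 0) \<longleftrightarrow>
      Dq (w (z, t)) (frechet_derivative w (at (z, t)) (0, 1)) +
      Df (w (z, t)) (frechet_derivative w (at (z, t)) (1, 0)) = 0"
    if "w ` U \<subseteq> W" "C1_on w U" "(z, t) \<in> U" for z t
  proof -
    define F where "F = frechet_derivative w (at (z, t))"
    have F: "(w has_derivative F) (at (z, t))" unfolding F_def using that by (intro C1_on_has_derivative)
    have W: "w (z, t) \<in> W" using that by blast
    interpret F: bounded_linear F using F by (rule has_derivative_bounded_linear)
    interpret q: bounded_linear "Dq (w (z, t))" using assms(1)[OF W] by (rule has_derivative_bounded_linear)
    interpret f: bounded_linear "Df (w (z, t))" using assms(2)[OF W] by (rule has_derivative_bounded_linear)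
    have lines: "((\<lambda>\<zeta>. (\<zeta>, t)) has_derivative (\<lambda>d. d *\<^sub>R (1, 0))) (at z)"
      "((\<lambda>\<tau>. (z, \<tau>)) has_derivative (\<lambda>d. d *\<^sub>R (0, 1))) (at t)"
      by (auto intro!: derivative_eq_intros)
    have "((\<lambda>\<tau>. fst S (w (z, \<tau>))) has_derivative (\<lambda>d. Dq (w (z, t)) (F (d *\<^sub>R (0, 1))))) (at t)"
      using has_derivative_compose[OF has_derivative_compose[OF lines(2) F] assms(1)[OF W]] .
    then have a: "((\<lambda>\<tau>. fst S (w (z, \<tau>))) has_vector_derivative Dq (w (z, t)) (F (0, 1))) (at t)"
      unfolding has_vector_derivative_def F.scaleR q.scaleR .
    have "((\<lambda>\<zeta>. snd S (w (\<zeta>, t))) has_derivative (\<lambda>d. Df (w (z, t)) (F (d *\<^sub>R (1, 0))))) (at z)"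
      using has_derivative_compose[OF has_derivative_compose[OF lines(1) F] assms(2)[OF W]] .
    then have b: "((\<lambda>\<zeta>. snd S (w (\<zeta>, t))) has_vector_derivative Df (w (z, t)) (F (1, 0))) (at z)"
      unfolding has_vector_derivative_def F.scaleR f.scaleR .
    show ?thesis unfolding F_def[symmetric]
      using a b vector_derivative_unique_at[OF a] vector_derivative_unique_at[OF b] by blast
  qed
  then show ?thesis unfolding classical_solution_def by fast
qed

context gas
begin

lemma frechet_lagrangian:
  assumes "w \<in> states D"
  shows "(fst (lagrangian h) has_derivative frechet_derivative (fst (lagrangian h)) (at w)) (at w)"
    and "(snd (lagrangian h) has_derivative frechet_derivative (snd (lagrangian h)) (at w)) (at w)"
  using has_derivative_lagrangian[OF assms] differentiableI frechet_derivative_works by blast+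

lemma frechet_eulerian:
  assumes "w \<in> states D"
  shows "(fst (eulerian h) has_derivative frechet_derivative (fst (eulerian h)) (at w)) (at w)"
    and "(snd (eulerian h) has_derivative frechet_derivative (snd (eulerian h)) (at w)) (at w)"
  using has_derivative_eulerian[OF assms] differentiableI frechet_derivative_works by blast+

lemma continuous_on_volume: "continuous_on (states D) (state_volume h)"
  and continuous_on_velocity: "continuous_on S velocity"
  using has_derivative_continuous[OF has_derivative_volume] has_derivative_continuous[OF has_derivative_velocity]
  by (blast intro: continuous_at_imp_continuous_on)+

lemma frames_related_imp_frame_change:
  assumes "frames_related h (states D) UL wL y UE wE x"
  shows "frame_change (states D) (state_volume h) velocity UL wL y UE wE x"
proof
  show "integral_of_form UE (\<lambda>P. 1 / state_volume h (wE P)) (\<lambda>P. - velocity (wE P) / state_volume h (wE P)) x"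
    using assms by (simp add: frames_related_def mass_density_def)
qed (use assms volume_pos continuous_on_volume continuous_on_velocity in \<open>auto simp: frames_related_def\<close>)

lemma frame_change_imp_frames_related:
  assumes "frame_change (states D) (state_volume h) velocity UL wL y UE wE x"
  shows "frames_related h (states D) UL wL y UE wE x"
proof -
  interpret frame_change "states D" "state_volume h" velocity UL wL y UE wE x by fact
  show ?thesis unfolding frames_related_def
    using open_U connected_U open_V connected_V g_into k_g flow_g k_into g_k flow_states flow'_states form_g form_k
    by (auto simp: mass_density_def)
qed

end

locale related_frames = gas +
  fixes UL wL y UE wE x
  assumes related: "frames_related h (states D) UL wL y UE wE x"
begin

sublocale L: frame_change "states D" "state_volume h" velocity UL wL y UE wE x
  using related by (rule frames_related_imp_frame_change)

sublocale E: frame_change "states D" "\<lambda>w. 1 / state_volume h w" "\<lambda>w. - velocity w / state_volume h w" UE wE x UL wL y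
  by (rule L.inverse_frame_change)

text \<open>
  By the chain rule the derivatives of the two flows are linked as the arguments in \<open>balance_iff\<close>.
\<close>

lemma classical_solution_frames:
  "classical_solution (lagrangian h) (states D) UL wL \<longleftrightarrow> classical_solution (eulerian h) (states D) UE wE"
proof -
  have eqs: "(\<forall>(z, t)\<in>UL. frechet_derivative (fst (lagrangian h)) (at (wL (z, t))) (frechet_derivative wL (at (z, t)) (0, 1)) +
        frechet_derivative (snd (lagrangian h)) (at (wL (z, t))) (frechet_derivative wL (at (z, t)) (1, 0)) = 0) \<longleftrightarrow>
      (\<forall>(z, t)\<in>UE. frechet_derivative (fst (eulerian h)) (at (wE (z, t))) (frechet_derivative wE (at (z, t)) (0, 1)) +
        frechet_derivative (snd (eulerian h)) (at (wE (z, t))) (frechet_derivative wE (at (z, t)) (1, 0)) = 0)"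
    (is "(\<forall>(z, t)\<in>UL. ?PL z t) \<longleftrightarrow> (\<forall>(z, t)\<in>UE. ?PE z t)") if C1: "C1_on wL UL"
  proof -
    have iff: "?PL z t \<longleftrightarrow> ?PE (y (z, t)) t" if P: "(z, t) \<in> UL" for z t
    proof -
      let ?F = "frechet_derivative wL (at (z, t))" and ?V = "state_volume h (wL (z, t))" and ?u = "velocity (wL (z, t))"
      interpret F: bounded_linear ?F
        using C1_on_has_derivative[OF C1 P] by (rule has_derivative_bounded_linear)
      have E: "frechet_derivative wE (at (y (z, t), t)) = (\<lambda>d. ?F ((fst d - ?u * snd d) / ?V, snd d))"
        using frechet_derivative_at[OF L.has_derivative_flow[OF C1 P]] by simp
      have "(- ?u / ?V, 1) = (0, 1) - (?u / ?V) *\<^sub>R (1, 0 :: real)" "(1 / ?V, 0) = (1 / ?V) *\<^sub>R (1, 0 :: real)"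
        by simp_all
      then have "?F (- ?u / ?V, 1) = ?F (0, 1) - (?u / ?V) *\<^sub>R ?F (1, 0)" "?F (1 / ?V, 0) = (1 / ?V) *\<^sub>R ?F (1, 0)"
        by (simp_all only: F.diff F.scaleR)
      then show ?thesis
        using balance_iff[OF L.flow_states[OF P], of "?F (0, 1)" "?F (1, 0)"] by (simp add: E L.flow_g[OF P])
    qed
    show ?thesis
    proof (intro iffI ballI)
      fix Q assume all: "\<forall>(z, t)\<in>UL. ?PL z t" and "Q \<in> UE"
      then obtain \<eta> t where Q: "Q = (\<eta>, t)" "(\<eta>, t) \<in> UE" by (cases Q) auto
      from all L.k_into[OF Q(2)] have "?PL (x (\<eta>, t)) t" by blast
      then have "?PE (y (x (\<eta>, t), t)) t" using iff[OF L.k_into[OF Q(2)]] by blast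
      then show "case Q of (z, t) \<Rightarrow> ?PE z t" by (simp only: L.g_k[OF Q(2)] Q(1) prod.case)
    next
      fix P assume all: "\<forall>(z, t)\<in>UE. ?PE z t" and "P \<in> UL"
      then obtain z t where P: "P = (z, t)" "(z, t) \<in> UL" by (cases P) auto
      from all L.g_into[OF P(2)] have "?PE (y (z, t)) t" by blast
      then have "?PL z t" using iff[OF P(2)] by blast
      then show "case P of (z, t) \<Rightarrow> ?PL z t" by (simp only: P(1) prod.case)
    qed
  qed
  have sub: "wL ` UL \<subseteq> states D" "wE ` UE \<subseteq> states D" using L.flow_states L.flow'_states by auto
  show ?thesis
  proof (cases "C1_on wL UL")
    case True
    then have "C1_on wE UE" using L.C1_on_flow_iff by blast
    with True sub eqs[OF True] show ?thesis
      by (simp only: classical_solution_iff[of "states D" "lagrangian h", OF frechet_lagrangian]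
          classical_solution_iff[of "states D" "eulerian h", OF frechet_eulerian] simp_thms)
  next
    case False
    then show ?thesis using L.C1_on_flow_iff unfolding classical_solution_def by blast
  qed
qed

lemma simple_wave_frames:
  "simple_wave (lagrangian h) (states D) i J \<gamma> UL wL \<longleftrightarrow> simple_wave (eulerian h) (states D) i J \<gamma> UE wE"
proof (cases "classical_solution (lagrangian h) (states D) UL wL")
  case True
  then have "C1_on wL UL" by (simp add: classical_solution_def)
  then have cont: "continuous_on UL wL" "continuous_on UE wE"
    using L.C1_on_flow_iff by (simp_all add: C1_on_continuous_on)
  have "(\<exists>\<phi>. C1_on \<phi> UL \<and> (\<forall>P\<in>UL. \<phi> P \<in> J \<and> wL P = \<gamma> (\<phi> P))) \<longleftrightarrow>
      (\<exists>\<phi>. C1_on \<phi> UE \<and> (\<forall>P\<in>UE. \<phi> P \<in> J \<and> wE P = \<gamma> (\<phi> P)))"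
    by (rule iffI, erule L.parametrisation[OF cont(1)], erule E.parametrisation[OF cont(2)])
  then show ?thesis
    using True classical_solution_frames by (simp only: simple_wave_def simple_wave_curve_iff simp_thms)
next
  case False
  then show ?thesis
    using classical_solution_frames by (simp only: simple_wave_def simp_thms)
qed

lemma jump_wave_frames:
  "jump_wave (lagrangian h) (states D) i wl wr \<sigma> UL wL \<longleftrightarrow>
    jump_wave (eulerian h) (states D) i wl wr (average velocity wl wr + average (state_volume h) wl wr * \<sigma>) UE wE"
proof (cases "shock_or_contact (lagrangian h) (states D) i wl wr \<sigma>")
  case True
  note s = speed_from_sides[OF True]
  let ?s = "average velocity wl wr + average (state_volume h) wl wr * \<sigma>"
  have "(\<exists>z0. \<forall>(z, t)\<in>UL. wL (z, t) = (if z < z0 + \<sigma> * t then wl else wr)) \<longleftrightarrow>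
      (\<exists>y0. \<forall>(z, t)\<in>UE. wE (z, t) = (if z < y0 + ?s * t then wl else wr))"
  proof
    assume "\<exists>z0. \<forall>(z, t)\<in>UL. wL (z, t) = (if z < z0 + \<sigma> * t then wl else wr)"
    then obtain z0 where "\<And>z t. (z, t) \<in> UL \<Longrightarrow> wL (z, t) = (if z < z0 + \<sigma> * t then wl else wr)" by blast
    from L.jump_flow[OF s(1-4) this]
    show "\<exists>y0. \<forall>(z, t)\<in>UE. wE (z, t) = (if z < y0 + ?s * t then wl else wr)" by blast
  next
    assume "\<exists>y0. \<forall>(z, t)\<in>UE. wE (z, t) = (if z < y0 + ?s * t then wl else wr)"
    then obtain y0 where "\<And>z t. (z, t) \<in> UE \<Longrightarrow> wE (z, t) = (if z < y0 + ?s * t then wl else wr)" by blast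
    from E.jump_flow[OF s(1,2,5,6) this]
    show "\<exists>z0. \<forall>(z, t)\<in>UL. wL (z, t) = (if z < z0 + \<sigma> * t then wl else wr)" by blast
  qed
  then show ?thesis using True shock_or_contact_iff unfolding jump_wave_def by blast
next
  case False
  then show ?thesis using shock_or_contact_iff unfolding jump_wave_def by blast
qed

lemma front_at_frames:
  assumes X: "\<forall>\<^sub>F \<tau> in nhds t. (X \<tau>, \<tau>) \<in> UL"
  shows "front_at (lagrangian h) (states D) i wl wr \<sigma> wL X t \<longleftrightarrow>
    front_at (eulerian h) (states D) i wl wr (average velocity wl wr + average (state_volume h) wl wr * \<sigma>)
      wE (\<lambda>\<tau>. y (X \<tau>, \<tau>)) t"
proof (cases "shock_or_contact (lagrangian h) (states D) i wl wr \<sigma>")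
  case True
  note s = speed_from_sides[OF True]
  define Y where "Y = (\<lambda>\<tau>. y (X \<tau>, \<tau>))"
  let ?s = "average velocity wl wr + average (state_volume h) wl wr * \<sigma>"
  have XU: "(X t, t) \<in> UL" using X by (rule eventually_nhds_x_imp_x)
  have "front_at (eulerian h) (states D) i wl wr ?s wE Y t"
    if "front_at (lagrangian h) (states D) i wl wr \<sigma> wL X t"
    using that L.front_flow[where X = X, OF XU, of \<sigma> wl wr] s(1-3) shock_or_contact_iff
    unfolding front_at_def Y_def by simp
  moreover have "front_at (lagrangian h) (states D) i wl wr \<sigma> wL X t"
    if E: "front_at (eulerian h) (states D) i wl wr ?s wE Y t"
  proof -
    have YU: "(Y t, t) \<in> UE" using L.g_into[OF XU] by (simp add: Y_def)
    \<comment> \<open>The path is recovered from its image only near \<open>t\<close>, which is all that matters.\<close>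
    have ev: "eventually (\<lambda>\<tau>. x (Y \<tau>, \<tau>) = X \<tau>) (nhds t)"
      using X by eventually_elim (simp add: Y_def L.k_g)
    then obtain N where N: "open N" "t \<in> N" "\<And>\<tau>. \<tau> \<in> N \<Longrightarrow> x (Y \<tau>, \<tau>) = X \<tau>"
      unfolding eventually_nhds by blast
    have XY: "x (Y t, t) = X t" using N by simp
    have box: "open (UNIV \<times> N :: (real \<times> real) set)" "(X t, t) \<in> UNIV \<times> N"
      using N by (auto intro: open_Times)
    have "at (X t, t) within {(z, \<tau>). z < x (Y \<tau>, \<tau>)} = at (X t, t) within {(z, \<tau>). z < X \<tau>}"
      "at (X t, t) within {(z, \<tau>). z > x (Y \<tau>, \<tau>)} = at (X t, t) within {(z, \<tau>). z > X \<tau>}"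
      by (rule at_within_nhd[OF box(2,1)]; use N(3) in auto)+
    moreover have "(X has_real_derivative d) (at t) \<longleftrightarrow> ((\<lambda>\<tau>. x (Y \<tau>, \<tau>)) has_real_derivative d) (at t)" for d
      by (rule DERIV_cong_ev) (use ev in \<open>auto elim: eventually_mono\<close>)
    ultimately show ?thesis
      using E E.front_flow[where X = Y, OF YU, of ?s wl wr] s(1,2,5) True
      unfolding front_at_def XY by simp
  qed
  ultimately show ?thesis unfolding Y_def by blast
next
  case False
  then show ?thesis using shock_or_contact_iff unfolding front_at_def by blast
qed

end

section \<open>Existence of corresponding frames\<close>

lemma antiderivative_on_open_interval:
  fixes F :: "real \<Rightarrow> real"
  assumes "open I" "is_interval I" and F: "continuous_on I F"
  shows "\<exists>G. \<forall>x\<in>I. (G has_real_derivative F x) (at x)"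
proof (cases "I = {}")
  case False
  then obtain c where "c \<in> I" by blast
  define G where "G = (\<lambda>x. if c \<le> x then integral {c..x} F else - integral {x..c} F)"
  have around: "\<exists>a b. a < x \<and> x < b \<and> a \<in> I \<and> b \<in> I" if "x \<in> I" for x
  proof -
    obtain e where "e > 0" "ball x e \<subseteq> I" using \<open>open I\<close> \<open>x \<in> I\<close> openE by blast
    then have "x - e / 2 \<in> I" "x + e / 2 \<in> I" by (auto simp: dist_real_def subset_iff)
    then show ?thesis using \<open>e > 0\<close> by (intro exI[of _ "x - e / 2"] exI[of _ "x + e / 2"]) auto
  qed
  have "(G has_real_derivative F x) (at x)" if "x \<in> I" for x
  proof -
    obtain a1 b1 a2 b2 where ab: "a1 < x" "x < b1" "a1 \<in> I" "b1 \<in> I" "a2 < c" "c < b2" "a2 \<in> I" "b2 \<in> I"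
      using around[OF \<open>x \<in> I\<close>] around[OF \<open>c \<in> I\<close>] by blast
    define a b where "a = min a1 a2" and "b = max b1 b2"
    have *: "a < x" "x < b" "a < c" "c < b" "a \<in> I" "b \<in> I" using ab by (auto simp: a_def b_def min_def max_def)
    have "{a..b} \<subseteq> I" using mem_is_interval_1_I[OF \<open>is_interval I\<close> *(5,6)] by auto
    then have cont: "continuous_on {a..b} F" using F continuous_on_subset by blast
    have int: "F integrable_on {u..v}" if "a \<le> u" "v \<le> b" for u v
      using that by (intro integrable_continuous_real continuous_on_subset[OF cont]) auto
    have G: "integral {a..y} F - integral {a..c} F = G y" if "y \<in> {a<..<b}" for y
      using that * Henstock_Kurzweil_Integration.integral_combine[where a = a and c = c and b = y and f = F]
        Henstock_Kurzweil_Integration.integral_combine[where a = a and c = y and b = c and f = F] int[of a y] int[of a c]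
      by (auto simp: G_def)
    have "((\<lambda>y. integral {a..y} F) has_real_derivative F x) (at x)"
      using integral_has_real_derivative[OF cont, of x] * by (simp add: at_within_Icc_at)
    then have "((\<lambda>y. integral {a..y} F - integral {a..c} F) has_real_derivative F x) (at x)"
      by (auto intro!: derivative_eq_intros)
    then show ?thesis
      by (rule has_field_derivative_transform_within_open[where S = "{a<..<b}"]) (use * G in auto)
  qed
  then show ?thesis by blast
qed simp

text \<open>
  Integrate in \<open>z\<close> on each horizontal line and in \<open>t\<close> on one vertical line. That the result also
  integrates the form on the other vertical lines is seen by varying the line: the error has zero
  derivative because the form is closed.
\<close>

lemma closed_form_on_rectangle:
  fixes \<alpha> \<beta> \<alpha>t :: "real \<times> real \<Rightarrow> real"
  assumes I: "open I" "is_interval I" and T: "open T" "is_interval T"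
    and \<alpha>: "continuous_on (I \<times> T) \<alpha>" and \<beta>: "continuous_on (I \<times> T) \<beta>" and \<alpha>t: "continuous_on (I \<times> T) \<alpha>t"
    and d\<alpha>: "\<And>z t. z \<in> I \<Longrightarrow> t \<in> T \<Longrightarrow> ((\<lambda>\<tau>. \<alpha> (z, \<tau>)) has_real_derivative \<alpha>t (z, t)) (at t)"
    and d\<beta>: "\<And>z t. z \<in> I \<Longrightarrow> t \<in> T \<Longrightarrow> ((\<lambda>\<zeta>. \<beta> (\<zeta>, t)) has_real_derivative \<alpha>t (z, t)) (at z)"
  shows "\<exists>g. integral_of_form (I \<times> T) \<alpha> \<beta> g"
proof (cases "I = {}")
  case True
  then show ?thesis by (auto simp: integral_of_form_def)
next
  case False
  then obtain z0 where "z0 \<in> I" by blast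
  have hor: "continuous_on I (\<lambda>\<zeta>. f (\<zeta>, t))" if "continuous_on (I \<times> T) f" "t \<in> T" for f :: "real \<times> real \<Rightarrow> real" and t
    by (rule continuous_on_compose2[OF that(1)]) (use that in \<open>auto intro!: continuous_intros\<close>)
  have ver: "continuous_on T (\<lambda>\<tau>. f (z, \<tau>))" if "continuous_on (I \<times> T) f" "z \<in> I" for f :: "real \<times> real \<Rightarrow> real" and z
    by (rule continuous_on_compose2[OF that(1)]) (use that in \<open>auto intro!: continuous_intros\<close>)
  have "\<forall>t\<in>T. \<exists>G. \<forall>z\<in>I. (G has_real_derivative \<alpha> (z, t)) (at z)"
    using antiderivative_on_open_interval[OF I hor[OF \<alpha>]] by blast
  then obtain G where G: "\<And>t z. t \<in> T \<Longrightarrow> z \<in> I \<Longrightarrow> (G t has_real_derivative \<alpha> (z, t)) (at z)"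
    by metis
  obtain H where H: "\<And>t. t \<in> T \<Longrightarrow> (H has_real_derivative \<beta> (z0, t)) (at t)"
    using antiderivative_on_open_interval[OF T ver[OF \<beta> \<open>z0 \<in> I\<close>]] by blast
  define g where "g = (\<lambda>(z, t). G t z - G t z0 + H t)"
  have "((\<lambda>\<zeta>. \<alpha> (\<zeta>, t)) has_integral (g (z2, t) - g (z1, t))) {z1..z2}"
    if "z1 \<le> z2" "{z1..z2} \<times> {t} \<subseteq> I \<times> T" for z1 z2 t
  proof -
    have "t \<in> T" "{z1..z2} \<subseteq> I" using that(1) subsetD[OF that(2), of "(_, t)"] by auto
    then have "((\<lambda>\<zeta>. \<alpha> (\<zeta>, t)) has_integral (G t z2 - G t z1)) {z1..z2}"
      by (intro fundamental_theorem_of_calculus \<open>z1 \<le> z2\<close>)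
        (auto simp: has_real_derivative_iff_has_vector_derivative[symmetric] intro!: has_field_derivative_at_within[OF G])
    then show ?thesis by (simp add: g_def)
  qed
  moreover have "((\<lambda>\<tau>. \<beta> (z, \<tau>)) has_integral (g (z, t2) - g (z, t1))) {t1..t2}"
    if "t1 \<le> t2" "{z} \<times> {t1..t2} \<subseteq> I \<times> T" for z t1 t2
  proof -
    have "z \<in> I" and T12: "{t1..t2} \<subseteq> T" "t1 \<in> T" "t2 \<in> T"
      using that(1) subsetD[OF that(2), of "(z, _)"] by auto
    have int: "(\<lambda>\<tau>. f (\<zeta>, \<tau>)) integrable_on {t1..t2}" if "continuous_on (I \<times> T) f" "\<zeta> \<in> I"
      for f :: "real \<times> real \<Rightarrow> real" and \<zeta>
      using continuous_on_subset[OF ver[OF that] T12(1)] by (rule integrable_continuous_real)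
    \<comment> \<open>Up to a constant, the error on the vertical line through \<open>\<zeta>\<close>; it is constant, and the choice of \<open>H\<close>
      makes the error zero at \<open>z0\<close>.\<close>
    define K where "K = (\<lambda>\<zeta>. G t2 \<zeta> - G t1 \<zeta> - integral {t1..t2} (\<lambda>\<tau>. \<beta> (\<zeta>, \<tau>)))"
    have "(K has_real_derivative 0) (at \<zeta> within I)" if "\<zeta> \<in> I" for \<zeta>
    proof -
      have "((\<lambda>\<zeta>. integral (cbox t1 t2) (\<lambda>\<tau>. \<beta> (\<zeta>, \<tau>))) has_real_derivative
          integral (cbox t1 t2) (\<lambda>\<tau>. \<alpha>t (\<zeta>, \<tau>))) (at \<zeta> within I)"
      proof (rule leibniz_rule_field_derivative[OF _ _ _ \<open>\<zeta> \<in> I\<close>])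
        show "((\<lambda>\<zeta>. \<beta> (\<zeta>, \<tau>)) has_real_derivative \<alpha>t (x, \<tau>)) (at x within I)"
          if "x \<in> I" "\<tau> \<in> cbox t1 t2" for x \<tau>
          by (rule has_field_derivative_at_within[OF d\<beta>]) (use that T12(1) in auto)
        show "(\<lambda>\<tau>. \<beta> (x, \<tau>)) integrable_on cbox t1 t2" if "x \<in> I" for x
          using int[OF \<beta> that] by simp
        show "continuous_on (I \<times> cbox t1 t2) (\<lambda>(x, \<tau>). \<alpha>t (x, \<tau>))"
          unfolding case_prod_eta using T12(1) by (intro continuous_on_subset[OF \<alpha>t] Sigma_mono) auto
        show "convex I" using I(2) by (simp add: is_interval_convex_1)
      qed
      moreover have "integral {t1..t2} (\<lambda>\<tau>. \<alpha>t (\<zeta>, \<tau>)) = \<alpha> (\<zeta>, t2) - \<alpha> (\<zeta>, t1)"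
        by (intro integral_unique fundamental_theorem_of_calculus \<open>t1 \<le> t2\<close>)
          (use T12(1) that in \<open>auto simp: has_real_derivative_iff_has_vector_derivative[symmetric] intro!: has_field_derivative_at_within[OF d\<alpha>]\<close>)
      moreover have "((\<lambda>\<zeta>. G t2 \<zeta> - G t1 \<zeta>) has_real_derivative \<alpha> (\<zeta>, t2) - \<alpha> (\<zeta>, t1)) (at \<zeta> within I)"
        using G T12 that by (intro DERIV_diff has_field_derivative_at_within[OF G]) auto
      ultimately show ?thesis unfolding K_def using DERIV_diff by fastforce
    qed
    then obtain c where c: "\<And>\<zeta>. \<zeta> \<in> I \<Longrightarrow> K \<zeta> = c"
      using has_field_derivative_zero_constant[of I K] I(2) by (auto simp: is_interval_convex_1)
    have "integral {t1..t2} (\<lambda>\<tau>. \<beta> (z0, \<tau>)) = H t2 - H t1"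
      by (intro integral_unique fundamental_theorem_of_calculus \<open>t1 \<le> t2\<close>)
        (use T12(1) in \<open>auto simp: has_real_derivative_iff_has_vector_derivative[symmetric] intro!: has_field_derivative_at_within[OF H]\<close>)
    then have "integral {t1..t2} (\<lambda>\<tau>. \<beta> (z, \<tau>)) = g (z, t2) - g (z, t1)"
      using c[OF \<open>z0 \<in> I\<close>] c[OF \<open>z \<in> I\<close>] by (simp add: K_def g_def)
    then show ?thesis using integrable_integral[OF int[OF \<beta> \<open>z \<in> I\<close>]] by simp
  qed
  ultimately show ?thesis unfolding integral_of_form_def by blast
qed

text \<open>
  On a rectangle the horizontal sections are intervals, on which the integral is strictly increasing;
  hence the new coordinate separates points, and its range is open by invariance of domain.
\<close>

lemma smooth_frame_change:
  assumes U: "open_rectangle U" and w: "continuous_on U w" and W: "\<And>P. P \<in> U \<Longrightarrow> w P \<in> W"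
    and A_pos: "\<And>x. x \<in> W \<Longrightarrow> A x > 0" and A: "continuous_on W A" and B: "continuous_on W B"
    and form: "integral_of_form U (\<lambda>P. A (w P)) (\<lambda>P. B (w P)) g"
  shows "\<exists>V w' k. frame_change W A B U w g V w' k"
proof -
  obtain I T where IT: "open I" "is_interval I" "open T" "is_interval T" "U = I \<times> T"
    using U by (auto simp: open_rectangle_def)
  have "open U" "connected U"
    using IT by (auto intro: open_Times connected_Times simp: is_interval_connected_1)
  have AB: "continuous_on U (\<lambda>P. A (w P))" "continuous_on U (\<lambda>P. B (w P))"
    using W by (auto intro!: continuous_on_compose2[OF A w] continuous_on_compose2[OF B w])
  have Dg: "(g has_derivative (\<lambda>d. A (w (z, t)) * fst d + B (w (z, t)) * snd d)) (at (z, t))" if "(z, t) \<in> U" for z t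
    using integral_of_form_has_derivative[OF form \<open>open U\<close> that AB] .
  then have g: "continuous_on U g"
    by (auto intro!: continuous_at_imp_continuous_on has_derivative_continuous[OF Dg])
  define \<Phi> where "\<Phi> = (\<lambda>P. (g P, snd P))"
  have \<Phi>: "continuous_on U \<Phi>" unfolding \<Phi>_def by (intro continuous_intros g)
  have less: "g (z1, t) < g (z2, t)" if "(z1, t) \<in> U" "(z2, t) \<in> U" "z1 < z2" for z1 z2 t
  proof (rule DERIV_pos_imp_increasing[OF \<open>z1 < z2\<close>])
    fix x assume x: "z1 \<le> x" "x \<le> z2"
    have P: "(x, t) \<in> U" using mem_is_interval_1_I[OF IT(2) _ _ x] that by (simp add: IT(5))
    have "((\<lambda>\<zeta>. (\<zeta>, t)) has_derivative (\<lambda>d. (d, 0))) (at x)" by (auto intro!: derivative_eq_intros)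
    from has_derivative_compose[OF this Dg[OF P]]
    have "((\<lambda>\<zeta>. g (\<zeta>, t)) has_real_derivative A (w (x, t))) (at x)" by (simp add: has_field_derivative_def)
    then show "\<exists>y. ((\<lambda>\<zeta>. g (\<zeta>, t)) has_real_derivative y) (at x) \<and> 0 < y" using A_pos W P by blast
  qed
  have inj: "inj_on \<Phi> U"
  proof (rule inj_onI, clarify)
    fix z t z' t' assume "(z, t) \<in> U" "(z', t') \<in> U" "\<Phi> (z, t) = \<Phi> (z', t')"
    then show "z = z' \<and> t = t'"
      using less[of z t z'] less[of z' t z] by (auto simp: \<Phi>_def) (metis less_irrefl linorder_less_linear)
  qed
  define V where "V = \<Phi> ` U"
  define k where "k = (\<lambda>Q. fst (inv_into U \<Phi> Q))"
  define w' where "w' = (\<lambda>Q. w (k Q, snd Q))"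
  have "open V" unfolding V_def by (rule invariance_of_domain[OF \<Phi> \<open>open U\<close> inj])
  have "connected V" unfolding V_def by (rule connected_continuous_image[OF \<Phi> \<open>connected U\<close>])
  have k_g: "k (g (z, t), t) = z" if "(z, t) \<in> U" for z t
    using inv_into_f_f[OF inj that] by (simp add: k_def \<Phi>_def)
  have flow: "w' (g (z, t), t) = w (z, t)" if "(z, t) \<in> U" for z t using k_g[OF that] by (simp add: w'_def)
  have V: "\<exists>z. (z, t) \<in> U \<and> y = g (z, t)" if "(y, t) \<in> V" for y t using that by (auto simp: V_def \<Phi>_def)
  have "(k has_derivative (\<lambda>d. (1 / A (w' (y, t))) * fst d + (- B (w' (y, t)) / A (w' (y, t))) * snd d)) (at (y, t))"
    if "(y, t) \<in> V" for y t
  proof -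
    obtain z where z: "(z, t) \<in> U" "y = g (z, t)" using V[OF \<open>(y, t) \<in> V\<close>] by blast
    have "A (w (z, t)) \<noteq> 0" using A_pos[OF W[OF z(1)]] by simp
    from has_derivative_fst[OF has_derivative_inverse_coordinate[OF \<open>open U\<close> z(1) g k_g Dg[OF z(1)] this]]
    have "(k has_derivative (\<lambda>d. (fst d - B (w (z, t)) * snd d) / A (w (z, t)))) (at (y, t))" by (simp add: z(2))
    then show ?thesis
      by (rule has_derivative_eq_rhs) (auto simp: z(2) flow[OF z(1)] diff_divide_distrib)
  qed
  from has_derivative_integral_of_form[OF this]
  have form_k: "integral_of_form V (\<lambda>P. 1 / A (w' P)) (\<lambda>P. - B (w' P) / A (w' P)) k" by simp
  have "frame_change W A B U w g V w' k"
  proof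
    show "(g (z, t), t) \<in> V" if "(z, t) \<in> U" for z t using that by (force simp: V_def \<Phi>_def)
    show "(k (y, t), t) \<in> U" "g (k (y, t), t) = y" if "(y, t) \<in> V" for y t
      using V[OF that] k_g by auto
  qed (fact \<open>open U\<close> \<open>connected U\<close> \<open>open V\<close> \<open>connected V\<close> k_g flow W A B form form_k | simp add: A_pos)+
  then show ?thesis by blast
qed

text \<open>
  Both coordinate maps are restrictions of mutually inverse piecewise linear maps of the plane;
  the new domain is the preimage of \<open>U\<close> under the inverse, hence open.
\<close>

lemma jump_frame_change:
  assumes U: "open U" "connected U" and lr: "wl \<in> W" "wr \<in> W"
    and s: "s = B wl + \<sigma> * A wl" "s = B wr + \<sigma> * A wr"
    and w: "\<And>z t. (z, t) \<in> U \<Longrightarrow> w (z, t) = (if z < z0 + \<sigma> * t then wl else wr)"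
    and A_pos: "\<And>x. x \<in> W \<Longrightarrow> A x > 0" and A: "continuous_on W A" and B: "continuous_on W B"
  shows "\<exists>g V w' k. frame_change W A B U w g V w' k"
proof -
  define g where "g = kinked_map z0 \<sigma> 0 s (A wl) (A wr)"
  define k where "k = kinked_map 0 s z0 \<sigma> (1 / A wl) (1 / A wr)"
  define w' where "w' = (\<lambda>(y, t). if y < 0 + s * t then wl else wr)"
  define \<Phi> where "\<Phi> = (\<lambda>P. (g P, snd P))"
  define \<Psi> where "\<Psi> = (\<lambda>Q. (k Q, snd Q))"
  have pos: "A wl > 0" "A wr > 0" using A_pos lr by auto
  then have pos': "1 / A wl > 0" "1 / A wr > 0" by auto
  have k_g: "k (g (z, t), t) = z" for z t
    unfolding g_def k_def by (rule kinked_map_inverse[OF pos])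
  have g_k: "g (k (y, t), t) = y" for y t
    using kinked_map_inverse[OF pos', of z0 \<sigma> 0 s y t] by (simp add: g_def k_def)
  have \<Phi>\<Psi>: "\<Phi> (\<Psi> Q) = Q" "\<Psi> (\<Phi> P) = P" for P Q
    by (cases Q, simp add: \<Phi>_def \<Psi>_def g_k) (cases P, simp add: \<Phi>_def \<Psi>_def k_g)
  have cont: "continuous_on X \<Phi>" "continuous_on X \<Psi>" for X
    unfolding \<Phi>_def \<Psi>_def g_def k_def by (intro continuous_intros continuous_on_kinked_map)+
  define V where "V = \<Psi> -` U"
  have "V = \<Phi> ` U"
  proof (intro equalityI subsetI)
    fix Q assume "Q \<in> V"
    then have "\<Phi> (\<Psi> Q) \<in> \<Phi> ` U" by (intro imageI) (simp add: V_def)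
    then show "Q \<in> \<Phi> ` U" by (simp only: \<Phi>\<Psi>)
  next
    fix Q assume "Q \<in> \<Phi> ` U"
    then obtain P where "P \<in> U" "Q = \<Phi> P" by blast
    then show "Q \<in> V" by (simp only: V_def vimage_eq \<Phi>\<Psi>)
  qed
  then have "connected V" using connected_continuous_image[OF cont(1) U(2)] by simp
  have "open V" unfolding V_def using cont(2) U(1) by (auto intro!: open_vimage)
  have "\<sigma> = - b / a + s * (1 / a)" if "a > 0" "s = b + \<sigma> * a" for a b
    using that(1) unfolding that(2) by (simp add: field_simps)
  note s' = this[OF pos(1) s(1)] this[OF pos(2) s(2)]
  have flow: "w' (g (z, t), t) = w (z, t)" if "(z, t) \<in> U" for z t
    using w[OF that] kinked_map_side[OF pos, of z0 \<sigma> 0 s z t] by (simp add: w'_def g_def)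
  have form_g: "integral_of_form U (\<lambda>P. A (w P)) (\<lambda>P. B (w P)) g"
    using integral_of_form_kinked_map[OF s, of U z0 0] unfolding g_def
    by (rule integral_of_form_cong[THEN iffD1, rotated 2]) (auto simp: w)
  have form_k: "integral_of_form V (\<lambda>P. 1 / A (w' P)) (\<lambda>P. - B (w' P) / A (w' P)) k"
    using integral_of_form_kinked_map[OF s', of V 0 z0] unfolding k_def
    by (rule integral_of_form_cong[THEN iffD1, rotated 2]) (auto simp: w'_def)
  have "frame_change W A B U w g V w' k"
  proof
    show "w P \<in> W" if "P \<in> U" for P using w that lr by (cases P) auto
    show "(g (z, t), t) \<in> V" if "(z, t) \<in> U" for z t
      using that k_g by (simp add: V_def \<Psi>_def)
    show "(k (y, t), t) \<in> U" if "(y, t) \<in> V" for y t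
      using that by (simp add: V_def \<Psi>_def)
  qed (fact U \<open>open V\<close> \<open>connected V\<close> flow A B form_g form_k | simp add: k_g g_k A_pos)+
  then show ?thesis by blast
qed

lemma frame_change_cong:
  assumes "frame_change W A B U w g V w' k" and "\<And>x. x \<in> W \<Longrightarrow> A x = A' x \<and> B x = B' x"
  shows "frame_change W A' B' U w g V w' k"
proof -
  interpret frame_change W A B U w g V w' k by fact
  show ?thesis
  proof
    show "A' x > 0" if "x \<in> W" for x using A_pos that assms(2) by metis
    show "continuous_on W A'" "continuous_on W B'"
      using A_continuous B_continuous assms(2) by (simp_all cong: continuous_on_cong)
    show "integral_of_form U (\<lambda>P. A' (w P)) (\<lambda>P. B' (w P)) g"
      using form_g by (rule integral_of_form_cong[THEN iffD1, rotated 2]) (simp_all add: assms(2) flow_states)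
    show "integral_of_form V (\<lambda>P. 1 / A' (w' P)) (\<lambda>P. - B' (w' P) / A' (w' P)) k"
      using form_k by (rule integral_of_form_cong[THEN iffD1, rotated 2]) (simp_all add: assms(2) flow'_states)
  qed (fact open_U connected_U open_V connected_V g_into k_g flow_g k_into g_k flow_states)+
qed

context gas
begin

lemma C1_on_volume: "C1_on (state_volume h) (states D)"
proof -
  have proj: "C1_on (\<lambda>w :: state. (fst w, snd (snd w))) (states D)"
    by (rule C1_onI[where F = "\<lambda>_ d. (fst d, snd (snd d))"])
      (auto intro!: derivative_eq_intros continuous_intros)
  have volume: "C1_on (\<lambda>(p, s). spec_volume h p s) D" using eos by (simp add: equation_of_state_def)
  have "C1_on (\<lambda>w. (\<lambda>(p, s). spec_volume h p s) (fst w, snd (snd w))) (states D)"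
    by (rule C1_on_compose[OF volume proj]) (auto simp: states_def)
  then show ?thesis by (simp add: state_volume_def case_prod_unfold)
qed

lemma C1_on_density: "C1_on (\<lambda>w. 1 / state_volume h w) (states D)"
proof -
  have "C1_on (\<lambda>x :: real. 1 / x) {0<..}"
    by (rule C1_onI[where F = "\<lambda>x d. - d / x\<^sup>2"])
      (auto intro!: derivative_eq_intros continuous_intros simp: power2_eq_square field_simps)
  from C1_on_compose[OF this C1_on_volume] show ?thesis by (simp add: volume_pos)
qed

text \<open>
  The mass balance of either system says that the form defining the coordinate of the other one is
  closed. The factor \<open>c = \<plusminus> 1\<close> is there because the Lagrangian mass balance has the density \<open>- v\<close>.
\<close>

lemma classical_frame_change:
  assumes U: "open_rectangle U" and sol: "classical_solution S (states D) U w"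
    and A: "C1_on A (states D)" and B: "continuous_on (states D) B" and A_pos: "\<And>x. x \<in> states D \<Longrightarrow> A x > 0"
    and mass: "\<And>x. A x = c * fst (fst S x)" "\<And>x. B x = - c * fst (snd S x)"
  shows "\<exists>g V w' k. frame_change (states D) A B U w g V w' k"
proof -
  obtain I T where IT: "open I" "is_interval I" "open T" "is_interval T" "U = I \<times> T"
    using U by (auto simp: open_rectangle_def)
  have W: "w P \<in> states D" if "P \<in> U" for P using sol that by (auto simp: classical_solution_def)
  have C1: "C1_on w U" using sol by (simp add: classical_solution_def)
  note w = C1_on_continuous_on[OF C1]
  define \<alpha> where "\<alpha> = (\<lambda>P. A (w P))"
  have \<alpha>: "C1_on \<alpha> U" unfolding \<alpha>_def by (rule C1_on_compose[OF A C1 W])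
  define \<alpha>t where "\<alpha>t = (\<lambda>P. frechet_derivative \<alpha> (at P) (0, 1))"
  have d\<alpha>: "((\<lambda>\<tau>. \<alpha> (z, \<tau>)) has_real_derivative \<alpha>t (z, t)) (at t)" if P: "(z, t) \<in> U" for z t
  proof -
    have D: "(\<alpha> has_derivative frechet_derivative \<alpha> (at (z, t))) (at (z, t))" using C1_on_has_derivative[OF \<alpha> P] .
    interpret F: bounded_linear "frechet_derivative \<alpha> (at (z, t))" using D by (rule has_derivative_bounded_linear)
    have "((\<lambda>\<tau>. (z, \<tau>)) has_derivative (\<lambda>d. d *\<^sub>R (0, 1))) (at t)" by (auto intro!: derivative_eq_intros)
    from has_derivative_compose[OF this D]
    show ?thesis unfolding F.scaleR by (simp add: has_field_derivative_def \<alpha>t_def mult.commute[of "frechet_derivative _ _ _"] mult_commute_abs)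
  qed
  have d\<beta>: "((\<lambda>\<zeta>. B (w (\<zeta>, t))) has_real_derivative \<alpha>t (z, t)) (at z)" if P: "(z, t) \<in> U" for z t
  proof -
    obtain a b where a: "((\<lambda>\<tau>. fst S (w (z, \<tau>))) has_vector_derivative a) (at t)"
      and b: "((\<lambda>\<zeta>. snd S (w (\<zeta>, t))) has_vector_derivative b) (at z)" and "a + b = 0"
      using sol P unfolding classical_solution_def by fast
    have "((\<lambda>\<tau>. fst (fst S (w (z, \<tau>)))) has_real_derivative fst a) (at t)"
      using bounded_linear.has_vector_derivative[OF bounded_linear_fst a]
      by (simp add: has_real_derivative_iff_has_vector_derivative)
    from DERIV_cmult[OF this, of c] have "((\<lambda>\<tau>. \<alpha> (z, \<tau>)) has_real_derivative c * fst a) (at t)"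
      by (simp add: \<alpha>_def mass)
    then have "\<alpha>t (z, t) = c * fst a" using DERIV_unique d\<alpha>[OF P] by blast
    also have "\<dots> = - c * fst b" using \<open>a + b = 0\<close> by (simp add: eq_neg_iff_add_eq_0[symmetric])
    finally have "\<alpha>t (z, t) = - c * fst b" .
    moreover have "((\<lambda>\<zeta>. fst (snd S (w (\<zeta>, t)))) has_real_derivative fst b) (at z)"
      using bounded_linear.has_vector_derivative[OF bounded_linear_fst b]
      by (simp add: has_real_derivative_iff_has_vector_derivative)
    ultimately show ?thesis using DERIV_cmult[of "\<lambda>\<zeta>. fst (snd S (w (\<zeta>, t)))" "fst b" z UNIV "- c"] by (simp add: mass(2))
  qed
  have "continuous_on U \<alpha>t" using \<alpha> by (simp add: C1_on_def \<alpha>t_def)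
  moreover have "continuous_on U (\<lambda>P. B (w P))" using W by (auto intro!: continuous_on_compose2[OF B w])
  ultimately have "\<exists>g. integral_of_form U \<alpha> (\<lambda>P. B (w P)) g"
    using closed_form_on_rectangle[OF IT(1-4), of \<alpha> "\<lambda>P. B (w P)" \<alpha>t] C1_on_continuous_on[OF \<alpha>] d\<alpha> d\<beta>
    unfolding IT(5) by simp
  then obtain g where "integral_of_form U (\<lambda>P. A (w P)) (\<lambda>P. B (w P)) g" unfolding \<alpha>_def by blast
  from smooth_frame_change[OF U w W A_pos C1_on_continuous_on[OF A] B this] show ?thesis by blast
qed

lemma open_rectangle_open_connected:
  assumes "open_rectangle U"
  shows "open U" "connected U"
  using assms by (auto simp: open_rectangle_def is_interval_connected_1 intro: open_Times connected_Times)

lemma lagrangian_wave_frames: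
  assumes U: "open_rectangle U"
    and wave: "(\<exists>J \<gamma>. simple_wave (lagrangian h) (states D) i J \<gamma> U w) \<or>
      (\<exists>wl wr \<sigma>. jump_wave (lagrangian h) (states D) i wl wr \<sigma> U w)"
  shows "\<exists>UE wE y x. frames_related h (states D) U w y UE wE x"
proof -
  have "\<exists>g V w' k. frame_change (states D) (state_volume h) velocity U w g V w' k"
    using wave
  proof (elim disjE exE)
    fix J \<gamma> assume "simple_wave (lagrangian h) (states D) i J \<gamma> U w"
    then have "classical_solution (lagrangian h) (states D) U w" by (simp add: simple_wave_def)
    from U this C1_on_volume continuous_on_velocity volume_pos show ?thesis
      by (rule classical_frame_change[where c = "- 1"]) (simp_all add: lagrangian_alt)
  next
    fix wl wr \<sigma> assume "jump_wave (lagrangian h) (states D) i wl wr \<sigma> U w"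
    then obtain z0 where sc: "shock_or_contact (lagrangian h) (states D) i wl wr \<sigma>"
      and w: "\<And>z t. (z, t) \<in> U \<Longrightarrow> w (z, t) = (if z < z0 + \<sigma> * t then wl else wr)"
      unfolding jump_wave_def by blast
    from jump_frame_change[where A = "state_volume h" and B = velocity,
        OF open_rectangle_open_connected[OF U] speed_from_sides(1-4)[OF sc] w volume_pos continuous_on_volume continuous_on_velocity]
    show ?thesis .
  qed
  then show ?thesis using frame_change_imp_frames_related by blast
qed

lemma eulerian_wave_frames:
  assumes U: "open_rectangle U"
    and wave: "(\<exists>J \<gamma>. simple_wave (eulerian h) (states D) i J \<gamma> U w) \<or>
      (\<exists>wl wr \<sigma>. jump_wave (eulerian h) (states D) i wl wr \<sigma> U w)"
  shows "\<exists>UL wL y x. frames_related h (states D) UL wL y U w x"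
proof -
  let ?A = "\<lambda>x. 1 / state_volume h x" and ?B = "\<lambda>x. - velocity x / state_volume h x"
  have A_pos: "?A x > 0" if "x \<in> states D" for x using volume_pos[OF that] by simp
  have B: "continuous_on (states D) ?B"
    using volume_pos by (intro continuous_intros continuous_on_volume continuous_on_velocity) force
  have "\<exists>g V w' k. frame_change (states D) ?A ?B U w g V w' k"
    using wave
  proof (elim disjE exE)
    fix J \<gamma> assume "simple_wave (eulerian h) (states D) i J \<gamma> U w"
    then have "classical_solution (eulerian h) (states D) U w" by (simp add: simple_wave_def)
    from U this C1_on_density B A_pos show ?thesis
      by (rule classical_frame_change[where c = 1]) (simp_all add: eulerian_alt)
  next
    fix wl wr s assume "jump_wave (eulerian h) (states D) i wl wr s U w"
    then obtain y0 where sc: "shock_or_contact (eulerian h) (states D) i wl wr s"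
      and w: "\<And>y t. (y, t) \<in> U \<Longrightarrow> w (y, t) = (if y < y0 + s * t then wl else wr)"
      unfolding jump_wave_def by blast
    then obtain \<sigma> where \<sigma>: "s = average velocity wl wr + average (state_volume h) wl wr * \<sigma>"
      using eulerian_speed_form[of wl wr s] unfolding shock_or_contact_def by blast
    with sc have L: "shock_or_contact (lagrangian h) (states D) i wl wr \<sigma>" using shock_or_contact_iff by simp
    from jump_frame_change[where A = ?A and B = ?B,
        OF open_rectangle_open_connected[OF U] speed_from_sides(1,2,5,6)[OF L, folded \<sigma>] w A_pos C1_on_continuous_on[OF C1_on_density] B]
    show ?thesis .
  qed
  then obtain x UL wL y where "frame_change (states D) ?A ?B U w x UL wL y" by blast
  from frame_change.inverse_frame_change[OF this]
  have "frame_change (states D) (state_volume h) velocity UL wL y U w x"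
    by (rule frame_change_cong) (use volume_pos in force)
  then show ?thesis using frame_change_imp_frames_related by blast
qed

end

theorem lemma8p2:
  fixes D :: "(real \<times> real) set" and h :: enthalpy and i :: family
  assumes "equation_of_state D h"
  shows
    "(\<forall>w \<in> states D.
        strictly_hyperbolic_at (lagrangian h) w \<and> strictly_hyperbolic_at (eulerian h) w \<and>
        wavespeed (eulerian h) i w = velocity w + state_volume h w * wavespeed (lagrangian h) i w \<and>
        (\<forall>r. gen_eigenpair (lagrangian h) w (wavespeed (lagrangian h) i w) r \<longleftrightarrow>
             gen_eigenpair (eulerian h) w (wavespeed (eulerian h) i w) r))
     \<and>
     (\<forall>J \<gamma>. simple_wave_curve (lagrangian h) (states D) i J \<gamma> \<longleftrightarrow>
             simple_wave_curve (eulerian h) (states D) i J \<gamma>)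
     \<and>
     (\<forall>wl wr \<sigma>L \<sigma>E.
        shock_or_contact (lagrangian h) (states D) i wl wr \<sigma>L \<and>
        shock_or_contact (eulerian h) (states D) i wl wr \<sigma>E \<longrightarrow>
        \<sigma>E = average velocity wl wr + average (state_volume h) wl wr * \<sigma>L)
     \<and>
     (\<forall>wl wr.
        ((\<exists>\<sigma>. shock_or_contact (lagrangian h) (states D) i wl wr \<sigma>) \<longleftrightarrow>
         (\<exists>\<sigma>. shock_or_contact (eulerian h) (states D) i wl wr \<sigma>)) \<and>
        ((\<exists>\<sigma>. lax_shock (lagrangian h) (states D) i wl wr \<sigma>) \<longleftrightarrow>
         (\<exists>\<sigma>. lax_shock (eulerian h) (states D) i wl wr \<sigma>)))
     \<and>
     (\<forall>UL wL y UE wE x. frames_related h (states D) UL wL y UE wE x \<longrightarrow>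
        (classical_solution (lagrangian h) (states D) UL wL \<longleftrightarrow>
         classical_solution (eulerian h) (states D) UE wE) \<and>
        (\<forall>J \<gamma>. simple_wave (lagrangian h) (states D) i J \<gamma> UL wL \<longleftrightarrow>
                simple_wave (eulerian h) (states D) i J \<gamma> UE wE) \<and>
        (\<forall>wl wr \<sigma>. jump_wave (lagrangian h) (states D) i wl wr \<sigma> UL wL \<longleftrightarrow>
                jump_wave (eulerian h) (states D) i wl wr
                  (average velocity wl wr + average (state_volume h) wl wr * \<sigma>) UE wE) \<and>
        (\<forall>wl wr \<sigma> X t. (\<forall>\<^sub>F \<tau> in nhds t. (X \<tau>, \<tau>) \<in> UL) \<longrightarrow>
           (front_at (lagrangian h) (states D) i wl wr \<sigma> wL X t \<longleftrightarrow>
            front_at (eulerian h) (states D) i wl wr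
              (average velocity wl wr + average (state_volume h) wl wr * \<sigma>)
              wE (\<lambda>\<tau>. y (X \<tau>, \<tau>)) t)))
     \<and>
     (\<forall>U w. open_rectangle U \<and>
        ((\<exists>J \<gamma>. simple_wave (lagrangian h) (states D) i J \<gamma> U w) \<or>
         (\<exists>wl wr \<sigma>. jump_wave (lagrangian h) (states D) i wl wr \<sigma> U w)) \<longrightarrow>
        (\<exists>UE wE y x. frames_related h (states D) U w y UE wE x))
     \<and>
     (\<forall>U w. open_rectangle U \<and>
        ((\<exists>J \<gamma>. simple_wave (eulerian h) (states D) i J \<gamma> U w) \<or>
         (\<exists>wl wr \<sigma>. jump_wave (eulerian h) (states D) i wl wr \<sigma> U w)) \<longrightarrow>
        (\<exists>UL wL y x. frames_related h (states D) UL wL y U w x))"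
proof -
  interpret gas D h by unfold_locales (fact assms)
  have rf: "related_frames D h UL wL y UE wE x" if "frames_related h (states D) UL wL y UE wE x" for UL wL y UE wE x
    using that by unfold_locales
  show ?thesis
  proof (intro conjI)
    show "\<forall>w \<in> states D.
        strictly_hyperbolic_at (lagrangian h) w \<and> strictly_hyperbolic_at (eulerian h) w \<and>
        wavespeed (eulerian h) i w = velocity w + state_volume h w * wavespeed (lagrangian h) i w \<and>
        (\<forall>r. gen_eigenpair (lagrangian h) w (wavespeed (lagrangian h) i w) r \<longleftrightarrow>
             gen_eigenpair (eulerian h) w (wavespeed (eulerian h) i w) r)"
      using wavespeeds gen_eigenpair_iff by simp
  qed (intro allI impI conjI;
      (elim conjE)?;
      (rule simple_wave_curve_iff same_shocks
        related_frames.classical_solution_frames[OF rf] related_frames.simple_wave_frames[OF rf]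
        related_frames.jump_wave_frames[OF rf] related_frames.front_at_frames[OF rf]
        shock_speeds lagrangian_wave_frames eulerian_wave_frames; assumption?))+
qed

end
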